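(* Let $L\ge4$ be an even integer, and consider the Hubbard Hamiltonian $H=H_I+H_h^p+H_h^g$ on the periodic $L\times L$ square lattice, with the hopping part split into its pink and gold plaquette parts. Then for every real $t$ the plaquette Trotter step $$e^{i(t/2)H_h^p}\,e^{itH_h^g}\,e^{i(t/2)H_h^p}\,e^{itH_I}$$ can, in a Jordan–Wigner encoding of the $2L^2$ fermionic modes into $2L^2$ qubits, be implemented exactly (up to global phase) by a quantum circuit consisting of Clifford gates together with at most $12L^2$ $T$-gates and at most $4L^2$ single-qubit $Z$-axis rotations $e^{i\theta Z}$.
   Context: The lattice sites are the elements of $(\mathbb{Z}/L\mathbb{Z})^2$; two sites are nearest neighbours if they differ by $(\pm1,0)$ or $(0,\pm1)$ modulo $L$, and an edge is an unordered pair of nearest neighbours. For each site $i$ and spin $\sigma\in\{\uparrow,\downarrow\}$ there is a fermionic mode with annihilation operator $a_{i,\sigma}$, satisfying the canonical anticommutation relations. Put $\hat z_{i,\sigma}=2a_{i,\sigma}^\dagger a_{i,\sigma}-\mathbb{1}$. With parameters $u>0$, $\tau>0$, the interaction Hamiltonian is $H_I=\frac{u}{4}\sum_i \hat z_{i,\uparrow}\hat z_{i,\downarrow}$ and the hopping Hamiltonian is $H_h=\tau\sum_\sigma\sum_{\{i,j\}\text{ edge}}(a_{i,\sigma}^\dagger a_{j,\sigma}+a_{j,\sigma}^\dagger a_{i,\sigma})$. The plaquette (unit square) with lower-left corner $(x,y)$ has vertices $(x,y),(x+1,y),(x+1,y+1),(x,y+1)$ (mod $L$) and the four edges around it. The pink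 plaquettes are those with $x,y$ both even, the gold ones those with $x,y$ both odd; for even $L$ every edge belongs to exactly one pink or gold plaquette. $H_h^p$ (resp. $H_h^g$) is the part of $H_h$ given by the sum over edges of pink (resp. gold) plaquettes. Jordan–Wigner encoding: fix an ordering of the modes $1,\dots,n$ ($n=2L^2$) and represent $a_k$ on $n$ qubits as $Z^{\otimes (k-1)}\otimes |0\rangle\langle1|\otimes \mathbb{1}^{\otimes(n-k)}$. Clifford gates are those generated by the Hadamard gate, the phase gate $\mathrm{diag}(1,i)$ and CNOT; the $T$-gate is $\mathrm{diag}(1,e^{i\pi/4})$, and its inverse is also counted as a $T$-gate. Each $Z$-axis rotation may have an arbitrary angle $\theta$. *)

theory Defs
  imports "Jordan_Normal_Form.Schur_Decomposition" "Jordan_Normal_Form.Jordan_Normal_Form"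
begin

section \<open>Matrices\<close>

text \<open>The index set is arbitrary, so the sum of \<open>N \<times> N\<close> matrices is taken entrywise.\<close>

definition mat_sum :: "nat \<Rightarrow> ('x \<Rightarrow> complex mat) \<Rightarrow> 'x set \<Rightarrow> complex mat" where
  "mat_sum N f S = mat N N (\<lambda>(i, j). \<Sum>x\<in>S. f x $$ (i, j))"

definition kron :: "complex mat \<Rightarrow> complex mat \<Rightarrow> complex mat" where
  "kron A B = mat (dim_row A * dim_row B) (dim_col A * dim_col B)
     (\<lambda>(i, j). A $$ (i div dim_row B, j div dim_col B) * B $$ (i mod dim_row B, j mod dim_col B))"

definition kron_list :: "complex mat list \<Rightarrow> complex mat" where
  "kron_list As = foldr kron As (1\<^sub>m 1)"

text \<open>For a square matrix the exponential series converges in every entry;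
  see \<open>mat_exp_summable\<close> below.\<close>

definition mat_exp :: "complex mat \<Rightarrow> complex mat" where
  "mat_exp A = mat (dim_row A) (dim_row A) (\<lambda>(i, j). \<Sum>k. (A ^\<^sub>m k) $$ (i, j) / fact k)"

definition exp_i :: "real \<Rightarrow> complex mat \<Rightarrow> complex mat" where
  "exp_i s A = mat_exp ((\<i> * complex_of_real s) \<cdot>\<^sub>m A)"

section \<open>Qubits, gates and circuits\<close>

definition pauli_Z :: "complex mat" where
  "pauli_Z = mat_of_rows_list 2 [[1, 0], [0, -1]]"

definition pauli_X :: "complex mat" where
  "pauli_X = mat_of_rows_list 2 [[0, 1], [1, 0]]"

definition ketbra :: "nat \<Rightarrow> nat \<Rightarrow> complex mat" where
  "ketbra a b = mat 2 2 (\<lambda>(i, j). if i = a \<and> j = b then 1 else 0)"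

text \<open>Qubits are numbered \<open>0, \<dots>, n - 1\<close>.\<close>

definition on_qubit :: "nat \<Rightarrow> nat \<Rightarrow> complex mat \<Rightarrow> complex mat" where
  "on_qubit n q U = kron_list (replicate q (1\<^sub>m 2) @ [U] @ replicate (n - Suc q) (1\<^sub>m 2))"

datatype gate =
    Hadamard nat
  | PhaseGate nat
  | CNOT nat nat  \<comment> \<open>control, target\<close>
  | TGate nat
  | TInverse nat
  | ZRotation real nat

fun valid_gate :: "nat \<Rightarrow> gate \<Rightarrow> bool" where
  "valid_gate n (Hadamard q) = (q < n)"
| "valid_gate n (PhaseGate q) = (q < n)"
| "valid_gate n (CNOT c q) = (c < n \<and> q < n \<and> c \<noteq> q)"
| "valid_gate n (TGate q) = (q < n)"
| "valid_gate n (TInverse q) = (q < n)"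
| "valid_gate n (ZRotation \<theta> q) = (q < n)"

fun gate_mat :: "nat \<Rightarrow> gate \<Rightarrow> complex mat" where
  "gate_mat n (Hadamard q) =
     on_qubit n q (complex_of_real (1 / sqrt 2) \<cdot>\<^sub>m mat_of_rows_list 2 [[1, 1], [1, -1]])"
| "gate_mat n (PhaseGate q) = on_qubit n q (mat_of_rows_list 2 [[1, 0], [0, \<i>]])"
| "gate_mat n (CNOT c q) =
     on_qubit n c (ketbra 0 0) + on_qubit n c (ketbra 1 1) * on_qubit n q pauli_X"
| "gate_mat n (TGate q) = on_qubit n q (mat_of_rows_list 2 [[1, 0], [0, cis (pi / 4)]])"
| "gate_mat n (TInverse q) = on_qubit n q (mat_of_rows_list 2 [[1, 0], [0, cis (- pi / 4)]])"
| "gate_mat n (ZRotation \<theta> q) = on_qubit n q (exp_i \<theta> pauli_Z)"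

text \<open>A circuit is a list of gates, the head being applied first.\<close>

fun circuit_mat :: "nat \<Rightarrow> gate list \<Rightarrow> complex mat" where
  "circuit_mat n [] = 1\<^sub>m (2 ^ n)"
| "circuit_mat n (g # gs) = circuit_mat n gs * gate_mat n g"

definition valid_circuit :: "nat \<Rightarrow> gate list \<Rightarrow> bool" where
  "valid_circuit n gs \<longleftrightarrow> (\<forall>g\<in>set gs. valid_gate n g)"

fun is_T :: "gate \<Rightarrow> bool" where
  "is_T (TGate q) = True"
| "is_T (TInverse q) = True"
| "is_T _ = False"

fun is_rotation :: "gate \<Rightarrow> bool" where
  "is_rotation (ZRotation \<theta> q) = True"
| "is_rotation _ = False"

definition T_count :: "gate list \<Rightarrow> nat" where
  "T_count gs = length (filter is_T gs)"

definition rotation_count :: "gate list \<Rightarrow> nat" where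
  "rotation_count gs = length (filter is_rotation gs)"

section \<open>The periodic lattice and its plaquettes\<close>

type_synonym site = "nat \<times> nat"

datatype spin = Up | Down

type_synonym mode = "site \<times> spin"

definition sites :: "nat \<Rightarrow> site set" where
  "sites L = {..<L} \<times> {..<L}"

definition modes :: "nat \<Rightarrow> mode set" where
  "modes L = sites L \<times> UNIV"

definition nearest_neighbours :: "nat \<Rightarrow> site \<Rightarrow> site \<Rightarrow> bool" where
  "nearest_neighbours L i j \<longleftrightarrow>
     (fst j = (fst i + 1) mod L \<and> snd j = snd i) \<or> (fst i = (fst j + 1) mod L \<and> snd j = snd i) \<or>
     (fst j = fst i \<and> snd j = (snd i + 1) mod L) \<or> (fst j = fst i \<and> snd i = (snd j + 1) mod L)"

definition edges :: "nat \<Rightarrow> site set set" where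
  "edges L = {{i, j} | i j. i \<in> sites L \<and> j \<in> sites L \<and> nearest_neighbours L i j}"

definition plaquette_edges :: "nat \<Rightarrow> site \<Rightarrow> site set set" where
  "plaquette_edges L = (\<lambda>(x, y).
     let x' = (x + 1) mod L; y' = (y + 1) mod L in
     {{(x, y), (x', y)}, {(x', y), (x', y')}, {(x', y'), (x, y')}, {(x, y'), (x, y)}})"

definition pink_plaquettes :: "nat \<Rightarrow> site set" where
  "pink_plaquettes L = {(x, y) \<in> sites L. even x \<and> even y}"

definition gold_plaquettes :: "nat \<Rightarrow> site set" where
  "gold_plaquettes L = {(x, y) \<in> sites L. odd x \<and> odd y}"

definition pink_edges :: "nat \<Rightarrow> site set set" where
  "pink_edges L = (\<Union>p\<in>pink_plaquettes L. plaquette_edges L p)"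

definition gold_edges :: "nat \<Rightarrow> site set set" where
  "gold_edges L = (\<Union>p\<in>gold_plaquettes L. plaquette_edges L p)"

section \<open>The Hubbard Hamiltonian in the Jordan--Wigner encoding\<close>

text \<open>The annihilation operator of the mode at position \<open>k\<close>, with positions starting at \<open>0\<close>.\<close>

definition jordan_wigner :: "nat \<Rightarrow> nat \<Rightarrow> complex mat" where
  "jordan_wigner n k =
     kron_list (replicate k pauli_Z @ [ketbra 0 1] @ replicate (n - Suc k) (1\<^sub>m 2))"

abbreviation num_modes :: "nat \<Rightarrow> nat" where
  "num_modes L \<equiv> 2 * L\<^sup>2"

text \<open>In the following, \<open>pos\<close> is the ordering of the modes: a bijection from \<open>modes L\<close>
  to \<open>{..<num_modes L}\<close>.\<close>

definition annihilate :: "nat \<Rightarrow> (mode \<Rightarrow> nat) \<Rightarrow> mode \<Rightarrow> complex mat" where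
  "annihilate L pos m = jordan_wigner (num_modes L) (pos m)"

definition create :: "nat \<Rightarrow> (mode \<Rightarrow> nat) \<Rightarrow> mode \<Rightarrow> complex mat" where
  "create L pos m = mat_adjoint (annihilate L pos m)"

definition z_hat :: "nat \<Rightarrow> (mode \<Rightarrow> nat) \<Rightarrow> mode \<Rightarrow> complex mat" where
  "z_hat L pos m =
     2 \<cdot>\<^sub>m (create L pos m * annihilate L pos m) - 1\<^sub>m (2 ^ num_modes L)"

definition H_interaction :: "nat \<Rightarrow> real \<Rightarrow> (mode \<Rightarrow> nat) \<Rightarrow> complex mat" where
  "H_interaction L u pos = complex_of_real (u / 4) \<cdot>\<^sub>m
     mat_sum (2 ^ num_modes L) (\<lambda>i. z_hat L pos (i, Up) * z_hat L pos (i, Down)) (sites L)"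

text \<open>For an edge \<open>e = {i, j}\<close> with \<open>i \<noteq> j\<close>, the ordered pairs of distinct elements of \<open>e\<close>
  are \<open>(i, j)\<close> and \<open>(j, i)\<close>, which give the two Hermitian conjugate hopping terms.\<close>

definition edge_hopping :: "nat \<Rightarrow> (mode \<Rightarrow> nat) \<Rightarrow> spin \<Rightarrow> site set \<Rightarrow> complex mat" where
  "edge_hopping L pos s e = mat_sum (2 ^ num_modes L)
     (\<lambda>(i, j). create L pos (i, s) * annihilate L pos (j, s)) {(i, j). i \<in> e \<and> j \<in> e \<and> i \<noteq> j}"

definition H_hopping_on ::
    "site set set \<Rightarrow> nat \<Rightarrow> real \<Rightarrow> (mode \<Rightarrow> nat) \<Rightarrow> complex mat" where
  "H_hopping_on E L \<tau> pos = complex_of_real \<tau> \<cdot>\<^sub>m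
     mat_sum (2 ^ num_modes L) (\<lambda>(s, e). edge_hopping L pos s e) (UNIV \<times> E)"

definition H_hopping :: "nat \<Rightarrow> real \<Rightarrow> (mode \<Rightarrow> nat) \<Rightarrow> complex mat" where
  "H_hopping L = H_hopping_on (edges L) L"

definition H_pink :: "nat \<Rightarrow> real \<Rightarrow> (mode \<Rightarrow> nat) \<Rightarrow> complex mat" where
  "H_pink L = H_hopping_on (pink_edges L) L"

definition H_gold :: "nat \<Rightarrow> real \<Rightarrow> (mode \<Rightarrow> nat) \<Rightarrow> complex mat" where
  "H_gold L = H_hopping_on (gold_edges L) L"

definition plaquette_trotter_step ::
    "nat \<Rightarrow> real \<Rightarrow> real \<Rightarrow> real \<Rightarrow> (mode \<Rightarrow> nat) \<Rightarrow> complex mat" where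
  "plaquette_trotter_step L u \<tau> t pos =
     exp_i (t / 2) (H_pink L \<tau> pos) * exp_i t (H_gold L \<tau> pos) *
     exp_i (t / 2) (H_pink L \<tau> pos) * exp_i t (H_interaction L u pos)"

section \<open>The definitions behave as intended\<close>

lemma mat_exp_summable:
  assumes A: "A \<in> carrier_mat n n" and ij: "i < n" "j < n"
  shows "summable (\<lambda>k. (A ^\<^sub>m k) $$ (i, j) / (fact k :: complex))"
proof -
  obtain B where B: "norm_bound A B"
    using norm_bound_max by blast
  have carr: "A ^\<^sub>m k \<in> carrier_mat n n" for k
    using A by simp
  have bound: "norm_bound (A ^\<^sub>m k) ((B * of_nat n) ^ k)" for k
  proof (induction k)
    case 0
    show ?case by (auto simp: norm_bound_def A)
  next
    case (Suc k)
    from norm_bound_mult[OF carr A Suc B] show ?case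
      by (simp add: mult_ac)
  qed
  have "norm ((A ^\<^sub>m k) $$ (i, j) / (fact k :: complex)) \<le> inverse (fact k) * (B * of_nat n) ^ k" for k
  proof -
    have "norm ((A ^\<^sub>m k) $$ (i, j)) \<le> (B * of_nat n) ^ k"
      using bound[of k] ij carrier_matD[OF carr[of k]] unfolding norm_bound_def by metis
    then show ?thesis
      by (simp add: norm_divide field_simps)
  qed
  then show ?thesis
    by (rule summable_comparison_test'[OF summable_exp, of 0])
qed

lemma cyclic_pred:
  assumes "even L" "y < L"
  obtains p where "p < L" "(p + 1) mod L = y" "even p \<longleftrightarrow> odd (y :: nat)"
proof (cases "y = 0")
  case True
  then show ?thesis using assms that[of "L - 1"] by auto
next
  case False
  then show ?thesis using assms that[of "y - 1"] by auto
qed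

lemma horizontal_edge:
  assumes "even L" "x < L" "y < L"
  shows "{(x, y), ((x + 1) mod L, y)} \<in> pink_edges L \<union> gold_edges L"
proof -
  obtain p where p: "p < L" "(p + 1) mod L = y" "even p \<longleftrightarrow> odd y"
    using cyclic_pred[OF assms(1,3)] .
  let ?e = "{(x, y), ((x + 1) mod L, y)}"
  have 1: "?e \<in> plaquette_edges L (x, y)" and 2: "?e \<in> plaquette_edges L (x, p)"
    using p(2) by (auto simp: plaquette_edges_def Let_def insert_commute)
  have "(x, y) \<in> pink_plaquettes L \<or> (x, y) \<in> gold_plaquettes L \<or>
        (x, p) \<in> pink_plaquettes L \<or> (x, p) \<in> gold_plaquettes L"
    using p assms by (auto simp: pink_plaquettes_def gold_plaquettes_def sites_def)
  then show ?thesis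
    using 1 2 unfolding pink_edges_def gold_edges_def by blast
qed

lemma vertical_edge:
  assumes "even L" "x < L" "y < L"
  shows "{(x, y), (x, (y + 1) mod L)} \<in> pink_edges L \<union> gold_edges L"
proof -
  obtain p where p: "p < L" "(p + 1) mod L = x" "even p \<longleftrightarrow> odd x"
    using cyclic_pred[OF assms(1,2)] .
  let ?e = "{(x, y), (x, (y + 1) mod L)}"
  have 1: "?e \<in> plaquette_edges L (x, y)" and 2: "?e \<in> plaquette_edges L (p, y)"
    using p(2) by (auto simp: plaquette_edges_def Let_def insert_commute)
  have "(x, y) \<in> pink_plaquettes L \<or> (x, y) \<in> gold_plaquettes L \<or>
        (p, y) \<in> pink_plaquettes L \<or> (p, y) \<in> gold_plaquettes L"
    using p assms by (auto simp: pink_plaquettes_def gold_plaquettes_def sites_def)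
  then show ?thesis
    using 1 2 unfolding pink_edges_def gold_edges_def by blast
qed

lemma plaquette_edges_subset:
  assumes "p \<in> sites L"
  shows "plaquette_edges L p \<subseteq> edges L"
proof -
  obtain x y where p: "p = (x, y)" by force
  define x' y' where "x' = (x + 1) mod L" and "y' = (y + 1) mod L"
  have s: "(x, y) \<in> sites L" "(x', y) \<in> sites L" "(x', y') \<in> sites L" "(x, y') \<in> sites L"
    using assms by (auto simp: sites_def p x'_def y'_def)
  have "nearest_neighbours L (x, y) (x', y)" "nearest_neighbours L (x', y) (x', y')"
    "nearest_neighbours L (x', y') (x, y')" "nearest_neighbours L (x, y') (x, y)"
    by (simp_all add: nearest_neighbours_def x'_def y'_def)
  with s show ?thesis
    unfolding plaquette_edges_def p Let_def prod.case x'_def[symmetric] y'_def[symmetric] edges_def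
    by blast
qed

lemma edges_split:
  assumes "even L"
  shows "edges L = pink_edges L \<union> gold_edges L"
proof
  show "edges L \<subseteq> pink_edges L \<union> gold_edges L"
  proof
    fix e assume "e \<in> edges L"
    then obtain x y x' y' where e: "e = {(x, y), (x', y')}"
      and L: "x < L" "y < L" "x' < L" "y' < L" and nn: "nearest_neighbours L (x, y) (x', y')"
      by (auto simp: edges_def sites_def)
    from nn consider "x' = (x + 1) mod L" "y' = y" | "x = (x' + 1) mod L" "y' = y"
      | "x' = x" "y' = (y + 1) mod L" | "x' = x" "y = (y' + 1) mod L"
      unfolding nearest_neighbours_def fst_conv snd_conv by blast
    then show "e \<in> pink_edges L \<union> gold_edges L"
    proof cases
      case 1 then show ?thesis using horizontal_edge[OF assms L(1,2)] by (simp add: e)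
    next
      case 2 then show ?thesis using horizontal_edge[OF assms L(3,4)] by (simp add: e insert_commute)
    next
      case 3 then show ?thesis using vertical_edge[OF assms L(1,2)] by (simp add: e)
    next
      case 4 then show ?thesis using vertical_edge[OF assms L(3,4)] by (simp add: e insert_commute)
    qed
  qed
  show "pink_edges L \<union> gold_edges L \<subseteq> edges L"
    using plaquette_edges_subset
    unfolding pink_edges_def gold_edges_def pink_plaquettes_def gold_plaquettes_def by blast
qed

lemma edges_split_disjoint:
  assumes "even L" "L \<ge> 4"
  shows "pink_edges L \<inter> gold_edges L = {}"
proof -
  define P :: "site set \<Rightarrow> bool" where
    "P e \<longleftrightarrow> (\<forall>i\<in>e. \<forall>j\<in>e. fst i div 2 = fst j div 2 \<and> snd i div 2 = snd j div 2)" for e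
  have ev: "(x + 1) mod L div 2 = x div 2" if "even x" "x < L" for x
  proof -
    have "x + 1 \<noteq> L" using that assms by auto
    then have "(x + 1) mod L = x + 1" using that by simp
    then show ?thesis using that by simp
  qed
  have od: "(x + 1) mod L div 2 \<noteq> x div 2" if "odd x" "x < L" for x
  proof (cases "x + 1 = L")
    case True
    then show ?thesis using assms by simp
  next
    case False
    then have "(x + 1) mod L = x + 1" using that by simp
    then show ?thesis using that by (auto elim!: oddE)
  qed
  have pink: "P e" if "e \<in> pink_edges L" for e
  proof -
    from that obtain x y where xy: "even x" "even y" "x < L" "y < L" "e \<in> plaquette_edges L (x, y)"
      by (auto simp: pink_edges_def pink_plaquettes_def sites_def)
    define x' y' where "x' = (x + 1) mod L" and "y' = (y + 1) mod L"
    have "x' div 2 = x div 2" "y' div 2 = y div 2"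
      using ev[OF xy(1,3)] ev[OF xy(2,4)] by (simp_all add: x'_def y'_def)
    with xy(5) show ?thesis
      unfolding plaquette_edges_def Let_def prod.case x'_def[symmetric] y'_def[symmetric]
      by (elim insertE emptyE) (simp_all add: P_def)
  qed
  have gold: "\<not> P e" if "e \<in> gold_edges L" for e
  proof -
    from that obtain x y where xy: "odd x" "odd y" "x < L" "y < L" "e \<in> plaquette_edges L (x, y)"
      by (auto simp: gold_edges_def gold_plaquettes_def sites_def)
    define x' y' where "x' = (x + 1) mod L" and "y' = (y + 1) mod L"
    have "x' div 2 \<noteq> x div 2" "y' div 2 \<noteq> y div 2"
      using od[OF xy(1,3)] od[OF xy(2,4)] by (simp_all add: x'_def y'_def)
    with xy(5) show ?thesis
      unfolding plaquette_edges_def Let_def prod.case x'_def[symmetric] y'_def[symmetric]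
      by (elim insertE emptyE) (simp_all add: P_def)
  qed
  from pink gold show ?thesis by blast
qed

lemma finite_edges: "finite (edges L)"
proof -
  have "edges L \<subseteq> Pow (sites L)" by (auto simp: edges_def)
  then show ?thesis by (rule finite_subset) (simp add: sites_def)
qed

lemma H_hopping_split:
  assumes "even L" "L \<ge> 4"
  shows "H_hopping L \<tau> pos = H_pink L \<tau> pos + H_gold L \<tau> pos"
proof -
  have fin: "finite (pink_edges L)" "finite (gold_edges L)"
    using finite_edges[of L] edges_split[OF assms(1)] by simp_all
  have "(UNIV :: spin set) = {Up, Down}"
    using spin.exhaust by auto
  then have "finite (UNIV :: spin set)"
    by (metis finite.emptyI finite.insertI)
  moreover have "(UNIV \<times> pink_edges L) \<inter> (UNIV \<times> gold_edges L) = ({} :: (spin \<times> _) set)"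
    using edges_split_disjoint[OF assms] by auto
  ultimately have sums: "sum f (UNIV \<times> edges L) =
      sum f (UNIV \<times> pink_edges L) + sum f (UNIV \<times> gold_edges L)"
    for f :: "spin \<times> site set \<Rightarrow> complex"
    unfolding edges_split[OF assms(1)] Sigma_Un_distrib2
    using fin by (intro sum.union_disjoint) auto
  show ?thesis
    unfolding H_hopping_def H_pink_def H_gold_def H_hopping_on_def mat_sum_def
    by (rule eq_matI) (simp_all add: sums distrib_left)
qed

end

(* Write the fermionic modes in Majorana operators g, h (two per mode, all anticommuting, with
   square 1). Up to the factor i every product of two of them is a Pauli string, hence conjugate to
   some Z by a Clifford circuit, so its exponential costs one Z-rotation, and one T-gate if the angle
   is pi/8.

   Summed over a plaquette with corners 0, 1, 2, 3, the hopping terms times i factorize as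
     -(1/2) ((g0 + g2) (h1 + h3) + (g1 + g3) (h0 + h2)),
   two commuting halves. Conjugation with exp (-pi/8 g0 g2) exp (-pi/8 h1 h3) turns g0 h1 into
   (1/2) (g0 + g2) (h1 + h3), so that the exponential of a half costs one Z-rotation and four T-gates.
   The L^2 halves of one colour commute, which gives 4 L^2 T-gates and L^2 rotations for each of the
   three hopping factors; the interaction costs one rotation for each site. *)

theory Submission
  imports "HOL-Analysis.Bounded_Linear_Function" "HOL-Analysis.Bounded_Continuous_Function" Defs
begin

section \<open>A Banach algebra containing all matrix algebras\<close>

text \<open>The angle pi/8 plays two parts. Conjugation doubles an angle, so pi/8 turns a Majorana
  operator by 45 degrees, into the sum of two operators with equal weights; and up to a phase it is
  the angle of the T-gate. Equal weights are what the hopping term offers: a 4-cycle is the complete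
  bipartite graph between {0, 2} and {1, 3}, which is also why the sum over its edges factorizes.
  The ordering of the modes is arbitrary, so a product of two Majorana operators may act on any
  number of qubits. No explicit Clifford circuit is written down for it. Instead, the Clifford
  conjugates of i Z are shown to be closed under products of anticommuting elements, and distant
  Majorana operators are reached through consecutive ones, whose products touch at most two qubits.
  The Jordan-Wigner strings thus never enter a gate count.\<close>

text \<open>Matrices whose size is not determined by a type do not form a ring type. Letting an
  \<open>N \<times> N\<close> matrix act block-diagonally on bounded sequences embeds all of them, with their unit,
  into one Banach algebra, where ring simplification and the library exponential apply.\<close>

text \<open>Completeness of \<open>bcontfun\<close> is available for metric domains only.\<close>

instantiation nat :: metric_space
begin

definition dist_nat :: "nat \<Rightarrow> nat \<Rightarrow> real" where
  "dist_nat m n = (if m = n then 0 else 1)"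

definition uniformity_nat :: "(nat \<times> nat) filter" where
  "uniformity_nat = (INF e\<in>{0<..}. principal {(x, y). dist x y < e})"

instance
proof
  fix U :: "nat set"
  have "\<forall>\<^sub>F (x', y) in uniformity. x' = x \<longrightarrow> y \<in> U" if "x \<in> U" for x
    unfolding uniformity_nat_def
    by (rule eventually_INF1[of 1]) (auto simp: eventually_principal dist_nat_def that split: if_splits)
  then show "open U = (\<forall>x\<in>U. \<forall>\<^sub>F (x', y) in uniformity. x' = x \<longrightarrow> y \<in> U)"
    by (auto simp: open_discrete)
qed (auto simp: dist_nat_def uniformity_nat_def)

end

instance bcontfun :: (metric_space, banach) banach ..

text \<open>A type of its own lets composition be the ring multiplication. Its elements are only
  real-linear, so complex numbers are not scalars of this algebra; they enter later as the operators
  \<open>scalar_op\<close>.\<close>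

typedef seq_op = "UNIV :: ((nat \<Rightarrow>\<^sub>C complex) \<Rightarrow>\<^sub>L (nat \<Rightarrow>\<^sub>C complex)) set"
  by blast

setup_lifting type_definition_seq_op

instantiation seq_op :: real_normed_algebra_1
begin

lift_definition zero_seq_op :: seq_op is 0 .
lift_definition one_seq_op :: seq_op is id_blinfun .
lift_definition plus_seq_op :: "seq_op \<Rightarrow> seq_op \<Rightarrow> seq_op" is "(+)" .
lift_definition minus_seq_op :: "seq_op \<Rightarrow> seq_op \<Rightarrow> seq_op" is "(-)" .
lift_definition uminus_seq_op :: "seq_op \<Rightarrow> seq_op" is uminus .
lift_definition times_seq_op :: "seq_op \<Rightarrow> seq_op \<Rightarrow> seq_op" is "(o\<^sub>L)" .
lift_definition scaleR_seq_op :: "real \<Rightarrow> seq_op \<Rightarrow> seq_op" is scaleR .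
lift_definition norm_seq_op :: "seq_op \<Rightarrow> real" is norm .
definition dist_seq_op :: "seq_op \<Rightarrow> seq_op \<Rightarrow> real" where "dist_seq_op x y = norm (x - y)"
definition sgn_seq_op :: "seq_op \<Rightarrow> seq_op" where "sgn_seq_op x = scaleR (inverse (norm x)) x"
definition uniformity_seq_op :: "(seq_op \<times> seq_op) filter" where
  "uniformity_seq_op = (INF e\<in>{0<..}. principal {(x, y). dist x y < e})"
definition open_seq_op :: "seq_op set \<Rightarrow> bool" where
  "open_seq_op S = (\<forall>x\<in>S. \<forall>\<^sub>F (x', y) in uniformity. x' = x \<longrightarrow> y \<in> S)"

text \<open>The constant sequence 1 witnesses that the sequence space is nonzero; on the zero space
  the identity would have norm 0.\<close>

lemma norm_id_bcontfun: "norm (id_blinfun :: (nat \<Rightarrow>\<^sub>C complex) \<Rightarrow>\<^sub>L _) = 1"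
proof -
  have "apply_bcontfun (const_bcontfun 1 :: nat \<Rightarrow>\<^sub>C complex) 0 \<noteq> apply_bcontfun 0 0"
    by (simp add: const_bcontfun.rep_eq zero_bcontfun.rep_eq)
  then have nz: "norm (const_bcontfun 1 :: nat \<Rightarrow>\<^sub>C complex) > 0"
    by (metis zero_less_norm_iff)
  have "norm (id_blinfun :: (nat \<Rightarrow>\<^sub>C complex) \<Rightarrow>\<^sub>L _) \<le> 1"
    by (rule norm_blinfun_bound) auto
  moreover have "1 * norm (const_bcontfun 1 :: nat \<Rightarrow>\<^sub>C complex) \<le>
      norm (id_blinfun :: (nat \<Rightarrow>\<^sub>C complex) \<Rightarrow>\<^sub>L _) * norm (const_bcontfun 1 :: nat \<Rightarrow>\<^sub>C complex)"
    using norm_blinfun[of id_blinfun "const_bcontfun 1 :: nat \<Rightarrow>\<^sub>C complex"] by simp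
  ultimately show ?thesis
    using nz by (simp add: mult_le_cancel_right)
qed

instance
proof
  show 1: "norm (1 :: seq_op) = 1"
    unfolding norm_seq_op.rep_eq one_seq_op.rep_eq by (rule norm_id_bcontfun)
  show "norm (x * y) \<le> norm x * norm y" for x y :: seq_op
    unfolding norm_seq_op.rep_eq times_seq_op.rep_eq by (rule norm_blinfun_compose)
  have "norm (0 :: seq_op) = 0"
    unfolding norm_seq_op.rep_eq zero_seq_op.rep_eq by (rule norm_zero)
  with 1 show "(0 :: seq_op) \<noteq> 1"
    by auto
  show "dist x y = norm (x - y)" for x y :: seq_op
    by (rule dist_seq_op_def)
  show "sgn x = inverse (norm x) *\<^sub>R x" for x :: seq_op
    by (rule sgn_seq_op_def)
  show "uniformity = (INF e\<in>{0<..}. principal {(x, y :: seq_op). dist x y < e})"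
    by (rule uniformity_seq_op_def)
  show "open U = (\<forall>x\<in>U. \<forall>\<^sub>F (x', y) in uniformity. x' = x \<longrightarrow> y \<in> U)" for U :: "seq_op set"
    by (rule open_seq_op_def)
  show "norm (x + y) \<le> norm x + norm y" for x y :: seq_op
    unfolding norm_seq_op.rep_eq plus_seq_op.rep_eq by (rule norm_triangle_ineq)
  fix a b c :: seq_op and r s :: real
  note rep = Rep_seq_op_inject[symmetric] zero_seq_op.rep_eq one_seq_op.rep_eq plus_seq_op.rep_eq
    minus_seq_op.rep_eq uminus_seq_op.rep_eq times_seq_op.rep_eq scaleR_seq_op.rep_eq norm_seq_op.rep_eq
  show "a + b + c = a + (b + c)" unfolding rep by (rule add.assoc)
  show "a + b = b + a" unfolding rep by (rule add.commute)
  show "0 + a = a" "- a + a = 0" "a - b = a + - b" unfolding rep by simp_all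
  show "r *\<^sub>R (a + b) = r *\<^sub>R a + r *\<^sub>R b" unfolding rep by (rule scaleR_add_right)
  show "(r + s) *\<^sub>R a = r *\<^sub>R a + s *\<^sub>R a" unfolding rep by (rule scaleR_add_left)
  show "r *\<^sub>R s *\<^sub>R a = (r * s) *\<^sub>R a" "1 *\<^sub>R a = a" unfolding rep by simp_all
  show "norm a = 0 \<longleftrightarrow> a = 0" "norm (r *\<^sub>R a) = \<bar>r\<bar> * norm a" unfolding rep by simp_all
  show "a * b * c = a * (b * c)" "1 * a = a" "a * 1 = a" unfolding rep by (simp_all add: blinfun_eqI)
  show "(a + b) * c = a * c + b * c" unfolding rep by (simp add: blinfun_eqI blinfun.add_left)
  show "a * (b + c) = a * b + a * c" unfolding rep by (simp add: blinfun_eqI blinfun.add_left blinfun.add_right)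
  show "r *\<^sub>R a * b = r *\<^sub>R (a * b)" unfolding rep by (simp add: blinfun_eqI blinfun.scaleR_left)
  show "a * r *\<^sub>R b = r *\<^sub>R (a * b)" unfolding rep by (simp add: blinfun_eqI blinfun.scaleR_left blinfun.scaleR_right)
qed

end

instance seq_op :: banach
proof
  fix X :: "nat \<Rightarrow> seq_op"
  have d: "dist x y = dist (Rep_seq_op x) (Rep_seq_op y)" for x y
    by (simp add: dist_seq_op_def dist_norm norm_seq_op.rep_eq minus_seq_op.rep_eq)
  assume "Cauchy X"
  then have "Cauchy (\<lambda>n. Rep_seq_op (X n))"
    by (simp add: Cauchy_def d)
  then obtain l where "(\<lambda>n. Rep_seq_op (X n)) \<longlonglongrightarrow> l"
    using Cauchy_convergent[of "\<lambda>n. Rep_seq_op (X n)"] unfolding convergent_def by auto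
  then have "X \<longlonglongrightarrow> Abs_seq_op l"
    by (simp add: tendsto_iff d Abs_seq_op_inverse)
  then show "convergent X"
    by (auto simp: convergent_def)
qed

section \<open>Matrix units acting blockwise on sequences\<close>

definition unit_fun :: "nat \<Rightarrow> nat \<Rightarrow> nat \<Rightarrow> complex \<Rightarrow> (nat \<Rightarrow>\<^sub>C complex) \<Rightarrow> (nat \<Rightarrow>\<^sub>C complex)" where
  "unit_fun N i j c v =
     Bcontfun (\<lambda>k. if k mod N = i then c * apply_bcontfun v (N * (k div N) + j) else 0)"

lemma apply_unit_fun:
  "apply_bcontfun (unit_fun N i j c v) k =
     (if k mod N = i then c * apply_bcontfun v (N * (k div N) + j) else 0)"
proof -
  have "norm (apply_bcontfun v k) \<le> norm v" for k
    using norm_bounded[of v k] .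
  then have "norm (if k mod N = i then c * apply_bcontfun v (N * (k div N) + j) else 0) \<le> norm c * norm v" for k
    by (auto simp: norm_mult intro!: mult_left_mono)
  then have "bounded (range (\<lambda>k. if k mod N = i then c * apply_bcontfun v (N * (k div N) + j) else 0))"
    by (intro boundedI[of _ "norm c * norm v"]) blast
  moreover have "continuous_on UNIV (\<lambda>k. if k mod N = i then c * apply_bcontfun v (N * (k div N) + j) else 0)"
    by simp
  ultimately show ?thesis
    unfolding unit_fun_def by (subst Bcontfun_inverse) (auto simp: bcontfun_def)
qed

lemma norm_unit_fun: "norm (unit_fun N i j c v) \<le> norm c * norm v"
  by (rule norm_bound) (auto simp: apply_unit_fun norm_mult intro!: mult_left_mono norm_bounded)

lemma bounded_linear_unit_fun: "bounded_linear (unit_fun N i j c)"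
proof (rule bounded_linear_intro[where K = "norm c"])
  show "norm (unit_fun N i j c v) \<le> norm v * norm c" for v
    using norm_unit_fun[of N i j c v] by (simp add: mult.commute)
qed (auto intro!: bcontfun_eqI simp: apply_unit_fun algebra_simps plus_bcontfun.rep_eq scaleR_bcontfun.rep_eq)

text \<open>The matrix with entry \<open>c\<close> at \<open>(i, j)\<close> and zeros elsewhere, acting on each of the
  consecutive blocks of length \<open>N\<close> of a bounded sequence.\<close>

definition unit_op :: "nat \<Rightarrow> nat \<Rightarrow> nat \<Rightarrow> complex \<Rightarrow> seq_op" where
  "unit_op N i j c = Abs_seq_op (Blinfun (unit_fun N i j c))"

lemma seq_op_eqI:
  "(\<And>v k. apply_bcontfun (blinfun_apply (Rep_seq_op A) v) k = apply_bcontfun (blinfun_apply (Rep_seq_op B) v) k)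
    \<Longrightarrow> A = B"
  by (metis Rep_seq_op_inject blinfun_eqI bcontfun_eqI)

lemma apply_unit_op: "blinfun_apply (Rep_seq_op (unit_op N i j c)) = unit_fun N i j c"
  by (simp add: unit_op_def Abs_seq_op_inverse bounded_linear_Blinfun_apply bounded_linear_unit_fun)

text \<open>The multiplication table of matrix units, from which multiplicativity of
  \<open>mat_op\<close> follows. The bound on j keeps \<open>N * b + j\<close> inside block b, so
  that \<open>div\<close> and \<open>mod\<close> recover b and j.\<close>

lemma unit_op_mult:
  assumes "j < N" "k < N"
  shows "unit_op N i j c * unit_op N k l d = (if j = k then unit_op N i l (c * d) else 0)"
  using assms
  by (auto intro!: seq_op_eqI simp: times_seq_op.rep_eq zero_seq_op.rep_eq apply_unit_op apply_unit_fun
     zero_bcontfun.rep_eq)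

lemma sum_unit_op: "N > 0 \<Longrightarrow> (\<Sum>i<N. unit_op N i i 1) = 1"
proof (rule seq_op_eqI)
  fix v k assume N: "N > 0"
  have 1: "Rep_seq_op (sum f S) = (\<Sum>i\<in>S. Rep_seq_op (f i))" for f and S :: "nat set"
    by (induction S rule: infinite_finite_induct) (auto simp: zero_seq_op.rep_eq plus_seq_op.rep_eq)
  have 2: "apply_bcontfun (sum f S) k = (\<Sum>i\<in>S. apply_bcontfun (f i) k)" for f :: "nat \<Rightarrow> nat \<Rightarrow>\<^sub>C complex" and S
    by (induction S rule: infinite_finite_induct) (auto simp: zero_bcontfun.rep_eq plus_bcontfun.rep_eq)
  show "apply_bcontfun (blinfun_apply (Rep_seq_op (\<Sum>i<N. unit_op N i i 1)) v) k =
    apply_bcontfun (blinfun_apply (Rep_seq_op 1) v) k"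
    using N by (simp add: 1 2 blinfun.sum_left apply_unit_op apply_unit_fun one_seq_op.rep_eq
        sum.If_cases sum.delta)
qed

lemma bounded_linear_unit_op: "bounded_linear (unit_op N i j)"
proof (rule bounded_linear_intro[where K = 1])
  show "norm (unit_op N i j c) \<le> norm c * 1" for c
    by (simp add: norm_seq_op.rep_eq)
      (rule norm_blinfun_bound, auto simp: apply_unit_op norm_unit_fun)
qed (auto intro!: seq_op_eqI simp: apply_unit_op apply_unit_fun plus_seq_op.rep_eq scaleR_seq_op.rep_eq
    blinfun.bilinear_simps plus_bcontfun.rep_eq scaleR_bcontfun.rep_eq algebra_simps)

lemma unit_op_zero [simp]: "unit_op N i j 0 = 0"
  using bounded_linear.linear[OF bounded_linear_unit_op] by (rule linear_0)

lemma unit_op_inject: 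
  assumes "unit_op N i j c = 0" "i < N"
  shows "c = 0"
proof -
  \<comment> \<open>Applied to the constant sequence 1, the operator has the value c at position
    i.\<close>
  have "apply_bcontfun (blinfun_apply (Rep_seq_op (unit_op N i j c)) (const_bcontfun 1)) i = 0"
    by (simp add: assms zero_seq_op.rep_eq zero_bcontfun.rep_eq)
  then show ?thesis using assms(2)
    by (simp add: apply_unit_op apply_unit_fun const_bcontfun.rep_eq)
qed

definition mat_op :: "nat \<Rightarrow> complex mat \<Rightarrow> seq_op" where
  "mat_op N A = (\<Sum>i<N. \<Sum>j<N. unit_op N i j (A $$ (i, j)))"

lemma mat_op_add:
  "A \<in> carrier_mat N N \<Longrightarrow> B \<in> carrier_mat N N \<Longrightarrow> mat_op N (A + B) = mat_op N A + mat_op N B"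
  by (simp add: mat_op_def bounded_linear_unit_op[THEN bounded_linear.linear, THEN linear_add] sum.distrib)

lemma mat_op_scaleR:
  "A \<in> carrier_mat N N \<Longrightarrow> mat_op N (complex_of_real r \<cdot>\<^sub>m A) = r *\<^sub>R mat_op N A"
  by (simp add: mat_op_def scaleR_sum_right scaleR_conv_of_real[of r, symmetric, where 'a = complex]
      bounded_linear_unit_op[THEN bounded_linear.linear, THEN linear_cmul])

lemma mat_op_uminus:
  "A \<in> carrier_mat N N \<Longrightarrow> mat_op N (- A) = - mat_op N A"
  by (simp add: mat_op_def sum_negf bounded_linear_unit_op[THEN bounded_linear.linear, THEN linear_neg])

lemma mat_op_mult:
  assumes "A \<in> carrier_mat N N" "B \<in> carrier_mat N N"
  shows "mat_op N (A * B) = mat_op N A * mat_op N B"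
proof -
  have lin: "unit_op N i j (sum f S) = (\<Sum>k\<in>S. unit_op N i j (f k))" for i j S and f :: "nat \<Rightarrow> complex"
    by (rule linear_sum[OF bounded_linear.linear[OF bounded_linear_unit_op]])
  have "mat_op N A * mat_op N B = (\<Sum>i<N. \<Sum>j<N. \<Sum>k<N. \<Sum>l<N.
      unit_op N i j (A $$ (i, j)) * unit_op N k l (B $$ (k, l)))"
    by (simp only: mat_op_def sum_distrib_right) (simp only: sum_distrib_left)
  also have "\<dots> = (\<Sum>i<N. \<Sum>j<N. \<Sum>k<N. \<Sum>l<N.
      if j = k then unit_op N i l (A $$ (i, j) * B $$ (k, l)) else 0)"
    by (intro sum.cong refl) (auto simp: unit_op_mult)
  also have "\<dots> = (\<Sum>i<N. \<Sum>j<N. \<Sum>l<N. \<Sum>k<N.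
      if j = k then unit_op N i l (A $$ (i, j) * B $$ (k, l)) else 0)"
    by (intro sum.cong refl sum.swap)
  also have "\<dots> = (\<Sum>i<N. \<Sum>j<N. \<Sum>l<N. unit_op N i l (A $$ (i, j) * B $$ (j, l)))"
    by (intro sum.cong refl) (simp add: sum.delta')
  also have "\<dots> = (\<Sum>i<N. \<Sum>l<N. \<Sum>j<N. unit_op N i l (A $$ (i, j) * B $$ (j, l)))"
    by (intro sum.cong refl sum.swap)
  also have "\<dots> = mat_op N (A * B)"
    unfolding mat_op_def using assms
    by (intro sum.cong refl) (simp add: scalar_prod_def lin atLeast0LessThan)
  finally show ?thesis ..
qed

lemma mat_op_one: "N > 0 \<Longrightarrow> mat_op N (1\<^sub>m N) = 1"
proof -
  assume N: "N > 0"
  have "mat_op N (1\<^sub>m N) = (\<Sum>i<N. \<Sum>j<N. if j = i then unit_op N i i 1 else 0)"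
    unfolding mat_op_def by (intro sum.cong refl) auto
  also have "\<dots> = 1"
    using N by (simp add: sum.delta sum_unit_op)
  finally show ?thesis .
qed

text \<open>Faithfulness of the embedding: through it, identities proved in \<open>seq_op\<close>
  come back to matrices.\<close>

lemma mat_op_inject:
  assumes "A \<in> carrier_mat N N" "B \<in> carrier_mat N N" "mat_op N A = mat_op N B"
  shows "A = B"
proof (rule eq_matI)
  fix i j assume ij: "i < dim_row B" "j < dim_col B"
  then have ij': "i < N" "j < N" using assms by auto
  \<comment> \<open>Multiplication by diagonal matrix units from both sides isolates the entry at
    (i, j).\<close>
  have pick: "unit_op N i i 1 * mat_op N M * unit_op N j j 1 = unit_op N i j (M $$ (i, j))" for M
  proof -
    have "unit_op N i i 1 * mat_op N M * unit_op N j j 1 =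
      (\<Sum>k<N. \<Sum>l<N. unit_op N i i 1 * unit_op N k l (M $$ (k, l)) * unit_op N j j 1)"
      by (simp add: mat_op_def sum_distrib_left sum_distrib_right)
    also have "\<dots> = (\<Sum>k<N. \<Sum>l<N. if l = j then if k = i then unit_op N i j (M $$ (i, j)) else 0 else 0)"
      by (intro sum.cong refl) (use ij' in \<open>auto simp: unit_op_mult\<close>)
    also have "\<dots> = unit_op N i j (M $$ (i, j))"
      using ij' by (simp add: sum.delta)
    finally show ?thesis .
  qed
  have "unit_op N i j (A $$ (i, j)) = unit_op N i j (B $$ (i, j))"
    using pick[of A] pick[of B] assms(3) by simp
  then have "unit_op N i j (A $$ (i, j) - B $$ (i, j)) = 0"
    by (simp add: linear_diff[OF bounded_linear.linear[OF bounded_linear_unit_op]])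
  then show "A $$ (i, j) = B $$ (i, j)"
    using unit_op_inject ij' by fastforce
qed (use assms in auto)

lemma mat_op_pow:
  assumes "A \<in> carrier_mat N N" "N > 0"
  shows "mat_op N (A ^\<^sub>m k) = mat_op N A ^ k"
proof (induction k)
  case 0
  then show ?case using assms by (simp add: mat_op_one)
next
  case (Suc k)
  have "mat_op N (A ^\<^sub>m Suc k) = mat_op N (A ^\<^sub>m k) * mat_op N A"
    using assms by (simp add: mat_op_mult[of _ N])
  then show ?case by (simp add: Suc power_commutes)
qed

text \<open>\<open>mat_exp\<close> is summed entry by entry. There are finitely many entries and
  \<open>unit_op\<close> is bounded linear in its entry, so the embedding may be taken inside the
  series.\<close>

lemma mat_op_mat_exp:
  assumes A: "A \<in> carrier_mat N N" and "N > 0"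
  shows "mat_op N (mat_exp A) = exp (mat_op N A)"
proof -
  have "(\<lambda>k. unit_op N i j ((A ^\<^sub>m k) $$ (i, j) / fact k)) sums unit_op N i j (mat_exp A $$ (i, j))"
    if "i < N" "j < N" for i j
    using bounded_linear.sums[OF bounded_linear_unit_op summable_sums[OF mat_exp_summable[OF A that]]]
      A that by (simp add: mat_exp_def)
  then have "(\<lambda>k. \<Sum>i<N. \<Sum>j<N. unit_op N i j ((A ^\<^sub>m k) $$ (i, j) / fact k)) sums mat_op N (mat_exp A)"
    unfolding mat_op_def by (intro sums_sum) auto
  moreover have "(\<Sum>i<N. \<Sum>j<N. unit_op N i j ((A ^\<^sub>m k) $$ (i, j) / fact k)) = mat_op N A ^ k /\<^sub>R fact k" for k
  proof -
    have "(\<Sum>i<N. \<Sum>j<N. unit_op N i j ((A ^\<^sub>m k) $$ (i, j) / fact k)) =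
        mat_op N (complex_of_real (inverse (fact k)) \<cdot>\<^sub>m (A ^\<^sub>m k))"
      unfolding mat_op_def using A pow_carrier_mat[OF A, of k]
      by (intro sum.cong refl) (simp add: field_simps)
    then show ?thesis
      using assms by (simp only: mat_op_scaleR[OF pow_carrier_mat[OF A]] mat_op_pow)
  qed
  ultimately have "(\<lambda>k. mat_op N A ^ k /\<^sub>R fact k) sums mat_op N (mat_exp A)"
    by simp
  then show ?thesis
    using exp_converges sums_unique2 by blast
qed

lemma mat_op_mat_sum:
  assumes "\<And>x. x \<in> S \<Longrightarrow> f x \<in> carrier_mat N N"
  shows "mat_op N (mat_sum N f S) = (\<Sum>x\<in>S. mat_op N (f x))"
proof -
  have lin: "unit_op N i j (sum f S) = (\<Sum>k\<in>S. unit_op N i j (f k))" for i j f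
    by (rule linear_sum[OF bounded_linear.linear[OF bounded_linear_unit_op]])
  have "mat_op N (mat_sum N f S) = (\<Sum>i<N. \<Sum>j<N. \<Sum>x\<in>S. unit_op N i j (f x $$ (i, j)))"
    unfolding mat_op_def by (intro sum.cong refl) (simp add: mat_sum_def lin)
  also have "\<dots> = (\<Sum>i<N. \<Sum>x\<in>S. \<Sum>j<N. unit_op N i j (f x $$ (i, j)))"
    by (intro sum.cong refl sum.swap)
  also have "\<dots> = (\<Sum>x\<in>S. mat_op N (f x))"
    unfolding mat_op_def by (rule sum.swap)
  finally show ?thesis .
qed

section \<open>Exponentials and anticommuting involutions\<close>

text \<open>Sending i to A extends to a continuous ring homomorphism on the complex numbers, which
  carries Euler's formula over.\<close>

lemma exp_scaleR_sqrt_minus_one: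
  fixes A :: "'a::{real_normed_algebra_1,banach}"
  assumes "A * A = -1"
  shows "exp (x *\<^sub>R A) = cos x *\<^sub>R 1 + sin x *\<^sub>R A"
proof -
  define h :: "complex \<Rightarrow> 'a" where "h z = Re z *\<^sub>R 1 + Im z *\<^sub>R A" for z
  have h: "bounded_linear h"
    unfolding h_def
    by (intro bounded_linear_add bounded_linear_scaleR_const bounded_linear_Re bounded_linear_Im)
  have mult: "h (w * z) = h w * h z" for w z
    using assms by (simp add: h_def algebra_simps)
  have pow: "h (z ^ k) = h z ^ k" for z k
    by (induction k) (simp_all add: mult, simp add: h_def)
  have "(\<lambda>k. h ((\<i> * complex_of_real x) ^ k /\<^sub>R fact k)) sums h (exp (\<i> * complex_of_real x))"
    by (rule bounded_linear.sums[OF h exp_converges])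
  moreover have "h (y /\<^sub>R fact k) = h y /\<^sub>R fact k" for y k
    using linear_cmul[OF bounded_linear.linear[OF h]] by blast
  ultimately have "(\<lambda>k. h (\<i> * complex_of_real x) ^ k /\<^sub>R fact k) sums h (exp (\<i> * complex_of_real x))"
    by (simp only: pow)
  then have "exp (h (\<i> * complex_of_real x)) = h (exp (\<i> * complex_of_real x))"
    using exp_converges sums_unique2 by blast
  then show ?thesis
    by (simp add: h_def cis_conv_exp[symmetric])
qed

lemma exp_conjugate:
  fixes A V W :: "'a::{real_normed_algebra_1,banach}"
  assumes "V * W = 1" "W * V = 1"
  shows "exp (W * A * V) = W * exp A * V"
proof -
  have pow: "W * A ^ k * V = (W * A * V) ^ k" for k
  proof (induction k)
    case (Suc k)
    have "W * A ^ Suc k * V = W * A * (V * W) * A ^ k * V"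
      by (simp add: assms mult.assoc)
    also have "\<dots> = W * A * V * (W * A ^ k * V)"
      by (simp only: mult.assoc)
    finally show ?case by (simp add: Suc)
  qed (simp add: assms)
  have bl: "bounded_linear (\<lambda>y. W * y * V)"
    by (intro bounded_linear_intros)
  have "(\<lambda>k. W * (A ^ k /\<^sub>R fact k) * V) sums (W * exp A * V)"
    by (rule bounded_linear.sums[OF bl exp_converges])
  then have "(\<lambda>k. (W * A * V) ^ k /\<^sub>R fact k) sums (W * exp A * V)"
    by (simp add: pow)
  then show ?thesis
    using exp_converges sums_unique2 by blast
qed

lemma exp_commute:
  fixes A B :: "'a::{real_normed_algebra_1,banach}"
  assumes "A * B = B * A"
  shows "exp A * B = B * exp A"
proof -
  have "A ^ k * B = B * A ^ k" for k
    using assms by (metis power_commuting_commutes)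
  then have "(\<lambda>k. B * (A ^ k /\<^sub>R fact k)) = (\<lambda>k. (A ^ k /\<^sub>R fact k) * B)"
    by (auto simp: fun_eq_iff)
  moreover have "(\<lambda>k. B * (A ^ k /\<^sub>R fact k)) sums (B * exp A)"
    by (intro sums_mult exp_converges)
  moreover have "(\<lambda>k. (A ^ k /\<^sub>R fact k) * B) sums (exp A * B)"
    by (intro sums_mult2 exp_converges)
  ultimately show ?thesis
    using sums_unique2 by metis
qed

lemma exp_minus_mult_exp: "exp (- A) * exp A = 1"
  for A :: "'a::{real_normed_algebra_1,banach}"
  using exp_minus_inverse[of "- A"] by simp

text \<open>Since p q squares to -1 and anticommutes with p, conjugation by its exponential with
  angle x turns p by 2 x in the plane of p and q; x = pi/8 leads to the diagonal direction p +
  q.\<close>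

lemma exp_rotate:
  fixes p q :: "'a::{real_normed_algebra_1,banach}"
  assumes "p * p = 1" "q * q = 1" "q * p = - (p * q)"
  shows "exp (- (pi / 8) *\<^sub>R (p * q)) * p * exp ((pi / 8) *\<^sub>R (p * q)) = (1 / sqrt 2) *\<^sub>R (p + q)"
proof -
  define c s where "c = cos (pi / 8)" and "s = sin (pi / 8)"
  \<comment> \<open>Versions with a trailing factor x, by which right-nested products are ordered
    with p in front of q.\<close>
  have r1: "p * (p * x) = x" "q * (q * x) = x" "q * (p * x) = - (p * (q * x))" for x
    using assms by (metis mult.assoc mult_1, metis mult.assoc mult_1, metis mult.assoc mult_minus_left)
  have "(p * q) * (p * q) = -1"
    by (simp add: mult.assoc assms r1)
  note e = exp_scaleR_sqrt_minus_one[OF this]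
  have "c * c - s * s = cos (2 * (pi / 8))" "c * s + c * s = sin (2 * (pi / 8))"
    unfolding c_def s_def cos_double sin_double by (simp_all add: power2_eq_square)
  moreover have "1 / sqrt 2 = sqrt 2 / (2 :: real)"
    by (simp add: field_simps)
  ultimately have cs: "c * c - s * s = 1 / sqrt 2" "c * s + c * s = 1 / sqrt 2"
    by (simp_all only: cos_45 sin_45 mult_2) (simp_all add: cos_45 sin_45)
  have "exp (- (pi / 8) *\<^sub>R (p * q)) * p * exp ((pi / 8) *\<^sub>R (p * q)) =
      (c *\<^sub>R 1 - s *\<^sub>R (p * q)) * p * (c *\<^sub>R 1 + s *\<^sub>R (p * q))"
    by (simp only: e c_def s_def cos_minus sin_minus) simp
  also have "\<dots> = (c * c - s * s) *\<^sub>R p + ((c * s) *\<^sub>R q + (c * s) *\<^sub>R q)"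
    by (simp add: algebra_simps assms r1)
  finally show ?thesis
    by (simp only: cs scaleR_add_left[symmetric] scaleR_add_right)
qed

text \<open>The rotation in the plane of p and q turns p and fixes r and s; the one in the plane of
  r and s turns r and fixes p. Each supplies a factor 1 / sqrt 2, which together make the
  1/2.\<close>

lemma exp_product_of_sums:
  fixes p q r s :: "'a::{real_normed_algebra_1,banach}"
  assumes sq: "p * p = 1" "q * q = 1" "r * r = 1" "s * s = 1"
    and ac: "q * p = - (p * q)" "s * r = - (r * s)" "r * p = - (p * r)" "r * q = - (q * r)"
      "s * p = - (p * s)" "s * q = - (q * s)"
  shows "exp (x *\<^sub>R ((1 / 2) *\<^sub>R ((p + q) * (r + s)))) =
    exp (- (pi / 8) *\<^sub>R (p * q)) * (exp (- (pi / 8) *\<^sub>R (r * s)) * (exp (x *\<^sub>R (p * r)) *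
      (exp ((pi / 8) *\<^sub>R (r * s)) * exp ((pi / 8) *\<^sub>R (p * q)))))"
proof -
  define G G' where "G = exp (- (pi / 8) *\<^sub>R (p * q))" and "G' = exp ((pi / 8) *\<^sub>R (p * q))"
  define K K' where "K = exp (- (pi / 8) *\<^sub>R (r * s))" and "K' = exp ((pi / 8) *\<^sub>R (r * s))"
  have inv: "G * G' = 1" "G' * G = 1" "K * K' = 1" "K' * K = 1"
    by (simp_all add: G_def G'_def K_def K'_def exp_minus_inverse exp_minus_mult_exp)
  \<comment> \<open>Passing c through two elements that anticommute with it costs two signs, which
    cancel.\<close>
  have even_comm: "(a * b) * c = c * (a * b)" if "c * a = - (a * c)" "c * b = - (b * c)" for a b c :: 'a
  proof -
    have "c * (a * b) = - (a * (c * b))"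
      by (metis that(1) mult.assoc mult_minus_left)
    then show ?thesis
      by (simp add: that(2) mult.assoc)
  qed
  have "G' * (r + s) = (r + s) * G'"
    unfolding G'_def
    by (intro exp_commute) (simp add: distrib_left distrib_right scaleR_add_right even_comm[OF ac(3,4)] even_comm[OF ac(5,6)])
  note G'_rs = this
  have "p * r = - (r * p)" "p * s = - (s * p)"
    by (simp_all add: ac)
  then have "K * p = p * K"
    unfolding K_def by (intro exp_commute) (simp add: even_comm)
  then have "G * K * (p * r) * (K' * G') = G * (p * (K * r * K')) * G'"
    by (metis mult.assoc)
  also have "\<dots> = (1 / sqrt 2) *\<^sub>R (G * p * ((r + s) * G'))"
    unfolding K_def K'_def exp_rotate[OF sq(3,4) ac(2)] by (simp add: mult.assoc)
  also have "\<dots> = (1 / sqrt 2) *\<^sub>R (G * p * G' * (r + s))"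
    by (simp add: G'_rs[symmetric] mult.assoc)
  also have "\<dots> = (1 / 2) *\<^sub>R ((p + q) * (r + s))"
    unfolding G_def G'_def exp_rotate[OF sq(1,2) ac(1)] by simp
  finally have "x *\<^sub>R ((1 / 2) *\<^sub>R ((p + q) * (r + s))) = G * K * (x *\<^sub>R (p * r)) * (K' * G')"
    by simp
  moreover have "(K' * G') * (G * K) = 1" "(G * K) * (K' * G') = 1"
    by (metis inv mult.assoc mult_1)+
  ultimately have "exp (x *\<^sub>R ((1 / 2) *\<^sub>R ((p + q) * (r + s)))) = G * K * exp (x *\<^sub>R (p * r)) * (K' * G')"
    by (simp only: exp_conjugate)
  then show ?thesis
    by (simp only: G_def G'_def K_def K'_def mult.assoc)
qed

section \<open>Tensor products of qubit operators\<close>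

lemma kron_carrier [intro]:
  "A \<in> carrier_mat m m' \<Longrightarrow> B \<in> carrier_mat k k' \<Longrightarrow> kron A B \<in> carrier_mat (m * k) (m' * k')"
  by (auto simp: kron_def)

text \<open>The mixed-product rule. The summation index below m * k is split into quotient and
  remainder by k, after which the double sum is a product.\<close>

lemma kron_mult:
  assumes A: "A \<in> carrier_mat m m" and B: "B \<in> carrier_mat k k"
    and C: "C \<in> carrier_mat m m" and D: "D \<in> carrier_mat k k"
  shows "kron A B * kron C D = kron (A * C) (B * D)"
proof (rule eq_matI)
  fix i j assume "i < dim_row (kron (A * C) (B * D))" "j < dim_col (kron (A * C) (B * D))"
  then have ij: "i < m * k" "j < m * k"
    using A D C by (auto simp: kron_def) (use B in auto)
  then have k: "k > 0" by (cases k) auto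
  from ij have dm: "i div k < m" "j div k < m" "i mod k < k" "j mod k < k"
    using k by (auto simp: less_mult_imp_div_less)
  have "(kron A B * kron C D) $$ (i, j) = (\<Sum>l<m * k. kron A B $$ (i, l) * kron C D $$ (l, j))"
    using A B C D ij by (auto simp: kron_def scalar_prod_def atLeast0LessThan)
  also have "\<dots> = (\<Sum>l<m * k. (A $$ (i div k, l div k) * C $$ (l div k, j div k)) *
      (B $$ (i mod k, l mod k) * D $$ (l mod k, j mod k)))"
    using A B C D ij by (intro sum.cong) (auto simp: kron_def)
  also have "\<dots> = (\<Sum>a<m. \<Sum>l = a * k..<a * k + k. (A $$ (i div k, l div k) * C $$ (l div k, j div k)) *
      (B $$ (i mod k, l mod k) * D $$ (l mod k, j mod k)))"
    by (rule sum.nat_group[symmetric])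
  also have "\<dots> = (\<Sum>a<m. \<Sum>b<k. (A $$ (i div k, a) * C $$ (a, j div k)) *
      (B $$ (i mod k, b) * D $$ (b, j mod k)))"
  proof (rule sum.cong[OF refl])
    fix a
    have "sum F {a * k..<a * k + k} = (\<Sum>b<k. F (b + a * k))" for F :: "nat \<Rightarrow> complex"
      using sum.shift_bounds_nat_ivl[of F 0 "a * k" k] by (simp add: add.commute atLeast0LessThan)
    then show "(\<Sum>l = a * k..<a * k + k. (A $$ (i div k, l div k) * C $$ (l div k, j div k)) *
      (B $$ (i mod k, l mod k) * D $$ (l mod k, j mod k))) = (\<Sum>b<k. (A $$ (i div k, a) * C $$ (a, j div k)) *
      (B $$ (i mod k, b) * D $$ (b, j mod k)))"
      by simp
  qed
  also have "\<dots> = (\<Sum>a<m. A $$ (i div k, a) * C $$ (a, j div k)) * (\<Sum>b<k. B $$ (i mod k, b) * D $$ (b, j mod k))"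
    by (simp only: sum_distrib_right) (simp only: sum_distrib_left)
  also have "\<dots> = kron (A * C) (B * D) $$ (i, j)"
    using A B C D ij dm by (auto simp: kron_def scalar_prod_def atLeast0LessThan)
  finally show "(kron A B * kron C D) $$ (i, j) = kron (A * C) (B * D) $$ (i, j)" .
qed (use assms in \<open>auto simp: kron_def\<close>)

lemma mat_adjoint_conv_mat: "mat_adjoint A = mat (dim_col A) (dim_row A) (\<lambda>(i, j). cnj (A $$ (j, i)))"
  by (rule eq_matI) (auto simp: mat_adjoint_def mat_of_rows_def)

lemma mat_adjoint_kron: "mat_adjoint (kron A B) = kron (mat_adjoint A) (mat_adjoint B)"
proof (rule eq_matI)
  fix i j
  assume "i < dim_row (kron (mat_adjoint A) (mat_adjoint B))" "j < dim_col (kron (mat_adjoint A) (mat_adjoint B))"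
  then have ij: "i < dim_col A * dim_col B" "j < dim_row A * dim_row B"
    by (auto simp: kron_def mat_adjoint_conv_mat)
  then have "dim_col B > 0" "dim_row B > 0"
    by (auto intro: gr0I)
  with ij show "mat_adjoint (kron A B) $$ (i, j) = kron (mat_adjoint A) (mat_adjoint B) $$ (i, j)"
    by (simp add: kron_def mat_adjoint_conv_mat less_mult_imp_div_less)
qed (auto simp: kron_def mat_adjoint_conv_mat)

lemma kron_list_carrier:
  "(\<forall>A\<in>set As. A \<in> carrier_mat 2 2) \<Longrightarrow> kron_list As \<in> carrier_mat (2 ^ length As) (2 ^ length As)"
  unfolding kron_list_def by (induction As) auto

lemma kron_list_mult:
  assumes "length As = length Bs" "\<forall>A\<in>set As. A \<in> carrier_mat 2 2" "\<forall>B\<in>set Bs. B \<in> carrier_mat 2 2"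
  shows "kron_list As * kron_list Bs = kron_list (map2 (*) As Bs)"
  using assms
proof (induction As Bs rule: list_induct2)
  case (Cons A As B Bs)
  then have "kron A (kron_list As) * kron B (kron_list Bs) = kron (A * B) (kron_list As * kron_list Bs)"
    using kron_list_carrier[of As] kron_list_carrier[of Bs] by (intro kron_mult) auto
  with Cons show ?case
    by (simp add: kron_list_def)
qed (simp add: kron_list_def)

lemma kron_list_adjoint: "mat_adjoint (kron_list As) = kron_list (map mat_adjoint As)"
proof (induction As)
  case Nil
  show ?case by (rule eq_matI) (auto simp: kron_list_def mat_adjoint_conv_mat)
qed (simp add: kron_list_def mat_adjoint_kron)

lemma kron_list_smult:
  "kron_list (As @ [c \<cdot>\<^sub>m A] @ Bs) = c \<cdot>\<^sub>m kron_list (As @ [A] @ Bs)"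
proof (induction As)
  case Nil
  have "kron (c \<cdot>\<^sub>m A) B = c \<cdot>\<^sub>m kron A B" for B
    by (rule eq_matI) (auto simp: kron_def less_mult_imp_div_less)
  then show ?case by (simp add: kron_list_def)
next
  case (Cons U As)
  have "kron A (c \<cdot>\<^sub>m B) = c \<cdot>\<^sub>m kron A B" for A B
    by (rule eq_matI, auto simp: kron_def less_mult_imp_div_less)
      (metis gr_implies_not0 index_smult_mat(1) mod_less_divisor mult_0_right neq0_conv mult.left_commute)
  with Cons show ?case by (simp add: kron_list_def)
qed

lemma kron_list_add:
  assumes "\<forall>M\<in>set (As @ [A, B] @ Bs). M \<in> carrier_mat 2 2"
  shows "kron_list (As @ [A + B] @ Bs) = kron_list (As @ [A] @ Bs) + kron_list (As @ [B] @ Bs)"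
  using assms
proof (induction As)
  case Nil
  then have "A \<in> carrier_mat 2 2" "B \<in> carrier_mat 2 2" by auto
  then have "kron (A + B) C = kron A C + kron B C" for C
    by (intro eq_matI) (auto simp: kron_def less_mult_imp_div_less distrib_right)
  then show ?case by (simp add: kron_list_def)
next
  case (Cons U As)
  have distr: "kron C (D + E) = kron C D + kron C E"
    if "D \<in> carrier_mat m m" "E \<in> carrier_mat m m" for C D E :: "complex mat" and m
  proof (rule eq_matI)
    fix i j assume "i < dim_row (kron C D + kron C E)" "j < dim_col (kron C D + kron C E)"
    then have ij: "i < dim_row C * m" "j < dim_col C * m" using that by (auto simp: kron_def)
    then have "m > 0" by (cases m) auto
    with ij that show "kron C (D + E) $$ (i, j) = (kron C D + kron C E) $$ (i, j)"
      by (auto simp: kron_def distrib_left)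
  qed (use that in \<open>auto simp: kron_def\<close>)
  show ?case
    using Cons kron_list_carrier[of "As @ [A] @ Bs"] kron_list_carrier[of "As @ [B] @ Bs"]
    by (simp add: kron_list_def) (rule distr[of _ "2 ^ Suc (length As + length Bs)"], auto)
qed

lemma kron_list_one: "kron_list (replicate k (1\<^sub>m 2)) = 1\<^sub>m (2 ^ k)"
proof (induction k)
  case (Suc k)
  have "kron (1\<^sub>m 2) (1\<^sub>m m) = 1\<^sub>m (2 * m)" for m
  proof (rule eq_matI)
    fix i j assume "i < dim_row (1\<^sub>m (2 * m))" "j < dim_col (1\<^sub>m (2 * m))"
    then have ij: "i < 2 * m" "j < 2 * m" by auto
    then have "m > 0" by auto
    moreover have "i div m < 2" "j div m < 2"
      using ij by (auto simp: less_mult_imp_div_less)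
    moreover have "i = j \<longleftrightarrow> i div m = j div m \<and> i mod m = j mod m"
      by (metis div_mult_mod_eq)
    ultimately show "kron (1\<^sub>m 2) (1\<^sub>m m) $$ (i, j) = (1\<^sub>m (2 * m) :: complex mat) $$ (i, j)"
      using ij by (auto simp: kron_def)
  qed (auto simp: kron_def)
  with Suc show ?case by (simp add: kron_list_def)
qed (simp add: kron_list_def)

section \<open>Product operators and complex scalars inside the Banach algebra\<close>

definition mat2 :: "(nat \<Rightarrow> complex mat) \<Rightarrow> bool" where
  "mat2 f \<longleftrightarrow> (\<forall>j. f j \<in> carrier_mat 2 2)"

text \<open>A product operator is given by a function from qubits to factors, so that products and
  adjoints are taken pointwise.\<close>

definition tensor :: "nat \<Rightarrow> (nat \<Rightarrow> complex mat) \<Rightarrow> complex mat" where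
  "tensor n f = kron_list (map f [0..<n])"

abbreviation qop :: "nat \<Rightarrow> complex mat \<Rightarrow> seq_op" where
  "qop n \<equiv> mat_op (2 ^ n)"

definition tensor_op :: "nat \<Rightarrow> (nat \<Rightarrow> complex mat) \<Rightarrow> seq_op" where
  "tensor_op n f = qop n (tensor n f)"

text \<open>Multiplication by c on the sequence space. It need not commute with an operator that is
  merely real-linear, so commutation is proved separately for embedded matrices and then for
  one-qubit operators and circuits.\<close>

definition scalar_op :: "nat \<Rightarrow> complex \<Rightarrow> seq_op" where
  "scalar_op n c = qop n (c \<cdot>\<^sub>m 1\<^sub>m (2 ^ n))"

lemma tensor_carrier [simp]: "mat2 f \<Longrightarrow> tensor n f \<in> carrier_mat (2 ^ n) (2 ^ n)"
  unfolding tensor_def using kron_list_carrier[of "map f [0..<n]"] by (auto simp: mat2_def)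

lemma tensor_op_mult:
  assumes "mat2 f" "mat2 g"
  shows "tensor_op n f * tensor_op n g = tensor_op n (\<lambda>j. f j * g j)"
proof -
  have "map2 (*) (map f xs) (map g xs) = map (\<lambda>j. f j * g j) xs" for xs
    by (induction xs) auto
  then have "tensor n f * tensor n g = tensor n (\<lambda>j. f j * g j)"
    using assms unfolding tensor_def by (subst kron_list_mult) (auto simp: mat2_def)
  then show ?thesis
    unfolding tensor_op_def using assms by (simp flip: mat_op_mult)
qed

lemma tensor_op_cong: "(\<And>j. j < n \<Longrightarrow> f j = g j) \<Longrightarrow> tensor_op n f = tensor_op n g"
  unfolding tensor_op_def tensor_def by (metis (mono_tags, lifting) atLeastLessThan_iff map_eq_conv set_upt)

lemma tensor_op_one: "(\<And>j. j < n \<Longrightarrow> f j = 1\<^sub>m 2) \<Longrightarrow> tensor_op n f = 1"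
proof -
  assume "\<And>j. j < n \<Longrightarrow> f j = 1\<^sub>m 2"
  then have "map f [0..<n] = replicate n (1\<^sub>m 2)"
    by (intro nth_equalityI) auto
  then show ?thesis
    by (simp add: tensor_op_def tensor_def kron_list_one mat_op_one)
qed

lemma map_upt_split: "q < n \<Longrightarrow> map f [0..<n] = map f [0..<q] @ [f q] @ map f [Suc q..<n]"
  using upt_add_eq_append[of 0 q "n - q"] by (simp add: upt_conv_Cons)

lemma scalar_op_mult_qop: "M \<in> carrier_mat (2 ^ n) (2 ^ n) \<Longrightarrow> scalar_op n c * qop n M = qop n (c \<cdot>\<^sub>m M)"
  unfolding scalar_op_def by (subst mat_op_mult[symmetric]) (auto simp: mult_smult_assoc_mat[of _ "2 ^ n" "2 ^ n"])

lemma scalar_op_commute: "M \<in> carrier_mat (2 ^ n) (2 ^ n) \<Longrightarrow> scalar_op n c * qop n M = qop n M * scalar_op n c"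
  unfolding scalar_op_def
  by (subst (1 2) mat_op_mult[symmetric])
    (auto simp: mult_smult_assoc_mat[of _ "2 ^ n" "2 ^ n"] mult_smult_distrib[of _ "2 ^ n" "2 ^ n" _ "2 ^ n"])

lemma tensor_op_smult:
  assumes "mat2 g" "q < n" "f q = c \<cdot>\<^sub>m g q" "\<And>j. j < n \<Longrightarrow> j \<noteq> q \<Longrightarrow> f j = g j"
  shows "tensor_op n f = scalar_op n c * tensor_op n g"
proof -
  have "map f [0..<q] = map g [0..<q]" "map f [Suc q..<n] = map g [Suc q..<n]"
    using assms(2,4) by auto
  then have "tensor n f = c \<cdot>\<^sub>m tensor n g"
    unfolding tensor_def map_upt_split[OF assms(2)] assms(3) by (simp only: kron_list_smult)
  then show ?thesis
    unfolding tensor_op_def using assms(1) by (simp add: scalar_op_mult_qop)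
qed

lemma tensor_op_add:
  assumes "mat2 g" "mat2 h" "q < n" "f q = g q + h q" "\<And>j. j < n \<Longrightarrow> j \<noteq> q \<Longrightarrow> f j = g j \<and> f j = h j"
  shows "tensor_op n f = tensor_op n g + tensor_op n h"
proof -
  have 1: "map f [0..<q] = map g [0..<q]" "map f [Suc q..<n] = map g [Suc q..<n]"
    using assms(3,5) by auto
  have "h j = g j" if "j < n" "j \<noteq> q" for j
    using assms(5)[OF that] by metis
  then have "map h [0..<q] = map g [0..<q]" "map h [Suc q..<n] = map g [Suc q..<n]"
    using assms(3) by auto
  note 1 = 1 this
  have "\<forall>M\<in>set (map g [0..<q] @ [g q, h q] @ map g [Suc q..<n]). M \<in> carrier_mat 2 2"
    using assms(1,2) by (auto simp: mat2_def)
  with 1 have "tensor n f = tensor n g + tensor n h"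
    unfolding tensor_def map_upt_split[OF assms(3)] assms(4) by (simp only: kron_list_add)
  then show ?thesis
    unfolding tensor_op_def using assms(1,2) by (simp add: mat_op_add)
qed

lemma tensor_adjoint: "mat_adjoint (tensor n f) = tensor n (\<lambda>j. mat_adjoint (f j))"
  unfolding tensor_def kron_list_adjoint by (simp add: comp_def)

lemma scalar_op_mult: "scalar_op n c * scalar_op n d = scalar_op n (c * d)"
proof -
  have "c \<cdot>\<^sub>m (d \<cdot>\<^sub>m 1\<^sub>m (2 ^ n)) = (c * d) \<cdot>\<^sub>m 1\<^sub>m (2 ^ n)"
    by (rule eq_matI) auto
  then show ?thesis
    by (simp add: scalar_op_def[of n d] scalar_op_mult_qop) (simp add: scalar_op_def)
qed

lemma scalar_op_of_real: "scalar_op n (complex_of_real r) = r *\<^sub>R 1"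
  by (simp add: scalar_op_def mat_op_scaleR mat_op_one)

lemma scalar_op_1 [simp]: "scalar_op n 1 = 1"
  using scalar_op_of_real[of n 1] by simp

lemma scalar_op_minus: "scalar_op n (- c) = - scalar_op n c"
  using scalar_op_mult[of n "-1" c] scalar_op_of_real[of n "-1"] by simp

text \<open>The only sign arises at qubit q; it is taken out of that one factor as the scalar
  -1.\<close>

lemma tensor_op_anticommute:
  assumes f: "mat2 f" and g: "mat2 g" and q: "q < n" "f q * g q = - (g q * f q)"
    and "\<And>j. j < n \<Longrightarrow> j \<noteq> q \<Longrightarrow> f j * g j = g j * f j"
  shows "tensor_op n f * tensor_op n g = - (tensor_op n g * tensor_op n f)"
proof -
  have "mat2 (\<lambda>j. g j * f j)"
    using f g unfolding mat2_def by (blast intro: mult_carrier_mat)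
  moreover have "f q * g q = (-1) \<cdot>\<^sub>m (g q * f q)"
    unfolding q(2) by (rule eq_matI) auto
  ultimately have "tensor_op n (\<lambda>j. f j * g j) = scalar_op n (-1) * tensor_op n (\<lambda>j. g j * f j)"
    using assms by (intro tensor_op_smult[of _ q]) auto
  then show ?thesis
    using f g by (simp add: tensor_op_mult scalar_op_minus)
qed

lemma tensor_op_commute:
  assumes "mat2 f" "mat2 g" "\<And>j. j < n \<Longrightarrow> f j * g j = g j * f j"
  shows "tensor_op n f * tensor_op n g = tensor_op n g * tensor_op n f"
  using assms by (simp add: tensor_op_mult cong: tensor_op_cong)

section \<open>Circuits\<close>

abbreviation M2 :: "complex \<Rightarrow> complex \<Rightarrow> complex \<Rightarrow> complex \<Rightarrow> complex mat" where
  "M2 a b c d \<equiv> mat_of_rows_list 2 [[a, b], [c, d]]"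

lemma M2_carrier [simp]: "M2 a b c d \<in> carrier_mat 2 2"
  by (auto simp: mat_of_rows_list_def)

lemma M2_entries [simp]:
  "M2 a b c d $$ (0, 0) = a" "M2 a b c d $$ (0, Suc 0) = b"
  "M2 a b c d $$ (Suc 0, 0) = c" "M2 a b c d $$ (Suc 0, Suc 0) = d"
  "dim_row (M2 a b c d) = 2" "dim_col (M2 a b c d) = 2"
  by (simp_all add: mat_of_rows_list_def)

lemma M2_eqI:
  assumes "A \<in> carrier_mat 2 2" "A $$ (0, 0) = a" "A $$ (0, Suc 0) = b" "A $$ (Suc 0, 0) = c"
    "A $$ (Suc 0, Suc 0) = d"
  shows "A = M2 a b c d"
proof (rule eq_matI)
  fix i j assume "i < dim_row (M2 a b c d)" "j < dim_col (M2 a b c d)"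
  then have "i = 0 \<or> i = Suc 0" "j = 0 \<or> j = Suc 0" by auto
  then show "A $$ (i, j) = M2 a b c d $$ (i, j)"
    using assms by auto
qed (use assms in auto)

lemma M2_mult: "M2 a b c d * M2 a' b' c' d' =
    M2 (a * a' + b * c') (a * b' + b * d') (c * a' + d * c') (c * b' + d * d')"
proof -
  have "{0..<2} = {0, Suc 0}" by auto
  then show ?thesis
    by (intro M2_eqI) (simp_all add: scalar_prod_def mult_carrier_mat[of _ 2 2])
qed

lemma M2_add: "M2 a b c d + M2 a' b' c' d' = M2 (a + a') (b + b') (c + c') (d + d')"
  by (rule M2_eqI) simp_all

lemma M2_smult: "x \<cdot>\<^sub>m M2 a b c d = M2 (x * a) (x * b) (x * c) (x * d)"
  by (rule M2_eqI) simp_all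

lemma M2_uminus: "- M2 a b c d = M2 (- a) (- b) (- c) (- d)"
  by (rule M2_eqI) simp_all

lemma M2_adjoint: "mat_adjoint (M2 a b c d) = M2 (cnj a) (cnj c) (cnj b) (cnj d)"
  by (rule M2_eqI) (simp_all add: mat_adjoint_conv_mat)

lemma M2_one: "1\<^sub>m 2 = M2 1 0 0 1"
  by (rule M2_eqI) auto

lemma M2_ketbra:
  "ketbra 0 0 = M2 1 0 0 0" "ketbra 0 (Suc 0) = M2 0 1 0 0" "ketbra (Suc 0) (Suc 0) = M2 0 0 0 1"
  by (rule M2_eqI; simp add: ketbra_def)+

lemmas M2_simps = M2_mult M2_add M2_smult M2_uminus M2_adjoint M2_one M2_ketbra pauli_X_def pauli_Z_def

definition on_site :: "nat \<Rightarrow> complex mat \<Rightarrow> nat \<Rightarrow> complex mat" where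
  "on_site q U j = (if j = q then U else 1\<^sub>m 2)"

definition site_op :: "nat \<Rightarrow> nat \<Rightarrow> complex mat \<Rightarrow> seq_op" where
  "site_op n q U = tensor_op n (on_site q U)"

lemma mat2_on_site [simp]: "U \<in> carrier_mat 2 2 \<Longrightarrow> mat2 (on_site q U)"
  by (auto simp: mat2_def on_site_def)

lemma on_qubit_tensor: "q < n \<Longrightarrow> on_qubit n q U = tensor n (on_site q U)"
proof -
  assume "q < n"
  then have "replicate q (1\<^sub>m 2) @ [U] @ replicate (n - Suc q) (1\<^sub>m 2) = map (on_site q U) [0..<n]"
    by (intro nth_equalityI) (auto simp: nth_append on_site_def nth_Cons split: nat.splits)
  then show ?thesis
    by (simp add: on_qubit_def tensor_def)
qed

lemma on_qubit_carrier [simp]: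
  "q < n \<Longrightarrow> U \<in> carrier_mat 2 2 \<Longrightarrow> on_qubit n q U \<in> carrier_mat (2 ^ n) (2 ^ n)"
  by (simp add: on_qubit_tensor)

lemma qop_on_qubit: "q < n \<Longrightarrow> qop n (on_qubit n q U) = site_op n q U"
  by (simp add: on_qubit_tensor site_op_def tensor_op_def)

lemma site_op_mult:
  assumes "U \<in> carrier_mat 2 2" "V \<in> carrier_mat 2 2"
  shows "site_op n q U * site_op n q V = site_op n q (U * V)"
proof -
  have "(\<lambda>j. on_site q U j * on_site q V j) = on_site q (U * V)"
    using assms by (auto simp: on_site_def)
  then show ?thesis
    using assms by (simp add: site_op_def tensor_op_mult)
qed

lemma site_op_commute:
  assumes "U \<in> carrier_mat 2 2" "V \<in> carrier_mat 2 2" "p \<noteq> q"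
  shows "site_op n p U * site_op n q V = site_op n q V * site_op n p U"
  unfolding site_op_def using assms by (intro tensor_op_commute) (auto simp: on_site_def)

lemma site_op_one: "site_op n q (1\<^sub>m 2) = 1"
  unfolding site_op_def by (rule tensor_op_one) (simp add: on_site_def)

lemma site_op_smult:
  "q < n \<Longrightarrow> U \<in> carrier_mat 2 2 \<Longrightarrow> site_op n q (c \<cdot>\<^sub>m U) = scalar_op n c * site_op n q U"
  unfolding site_op_def by (rule tensor_op_smult[of _ q]) (auto simp: on_site_def)

lemma site_op_scaleR:
  "q < n \<Longrightarrow> U \<in> carrier_mat 2 2 \<Longrightarrow> site_op n q (complex_of_real r \<cdot>\<^sub>m U) = r *\<^sub>R site_op n q U"
  by (simp add: site_op_smult scalar_op_of_real)

lemma site_op_add: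
  "q < n \<Longrightarrow> U \<in> carrier_mat 2 2 \<Longrightarrow> V \<in> carrier_mat 2 2 \<Longrightarrow> site_op n q (U + V) = site_op n q U + site_op n q V"
  unfolding site_op_def by (rule tensor_op_add[of _ _ q]) (auto simp: on_site_def)

lemma site_op_uminus:
  "q < n \<Longrightarrow> U \<in> carrier_mat 2 2 \<Longrightarrow> site_op n q (- U) = - site_op n q U"
proof -
  assume "q < n" "U \<in> carrier_mat 2 2"
  moreover have "- U = (-1) \<cdot>\<^sub>m U"
    by (rule eq_matI) auto
  ultimately show ?thesis
    by (simp add: site_op_smult scalar_op_minus)
qed

lemma scalar_op_commute_site:
  "q < n \<Longrightarrow> U \<in> carrier_mat 2 2 \<Longrightarrow> scalar_op n c * site_op n q U = site_op n q U * scalar_op n c"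
  unfolding site_op_def tensor_op_def by (rule scalar_op_commute) simp

section \<open>Circuits up to a global phase, and Clifford pairs\<close>

definition circuit_op :: "nat \<Rightarrow> gate list \<Rightarrow> seq_op" where
  "circuit_op n gs = qop n (circuit_mat n gs)"

text \<open>With i moved into the matrix, the exponent is a real multiple of an element of square
  -1, so its exponential is cos plus sin in the image of the 2 by 2 matrices.\<close>

lemma exp_i_pauli_Z: "exp_i x pauli_Z = M2 (cis x) 0 0 (cis (- x))"
proof -
  have *: "(\<i> * complex_of_real x) \<cdot>\<^sub>m pauli_Z = complex_of_real x \<cdot>\<^sub>m M2 \<i> 0 0 (- \<i>)"
    by (simp add: M2_simps mult.commute)
  have one: "mat_op 2 (M2 1 0 0 1) = 1"
    using mat_op_one[of 2] by (simp add: M2_one)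
  have "mat_op 2 (M2 \<i> 0 0 (- \<i>)) * mat_op 2 (M2 \<i> 0 0 (- \<i>)) = mat_op 2 (- M2 1 0 0 1)"
    by (simp add: M2_simps flip: mat_op_mult)
  then have sq: "mat_op 2 (M2 \<i> 0 0 (- \<i>)) * mat_op 2 (M2 \<i> 0 0 (- \<i>)) = - 1"
    by (subst (asm) mat_op_uminus) (auto simp: one)
  have "mat_op 2 (exp_i x pauli_Z) = exp (x *\<^sub>R mat_op 2 (M2 \<i> 0 0 (- \<i>)))"
    unfolding exp_i_def * by (subst mat_op_mat_exp) (auto simp: mat_op_scaleR)
  also have "\<dots> = cos x *\<^sub>R mat_op 2 (M2 1 0 0 1) + sin x *\<^sub>R mat_op 2 (M2 \<i> 0 0 (- \<i>))"
    by (simp add: exp_scaleR_sqrt_minus_one[OF sq] one)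
  also have "\<dots> = mat_op 2 (complex_of_real (cos x) \<cdot>\<^sub>m M2 1 0 0 1 + complex_of_real (sin x) \<cdot>\<^sub>m M2 \<i> 0 0 (- \<i>))"
    by (subst mat_op_add) (auto simp: mat_op_scaleR)
  also have "complex_of_real (cos x) \<cdot>\<^sub>m M2 1 0 0 1 + complex_of_real (sin x) \<cdot>\<^sub>m M2 \<i> 0 0 (- \<i>) =
      M2 (cis x) 0 0 (cis (- x))"
  proof -
    have "complex_of_real (cos x) + complex_of_real (sin x) * \<i> = cis x"
      "complex_of_real (cos x) + - (complex_of_real (sin x) * \<i>) = cis (- x)"
      by (simp_all add: complex_eq_iff)
    then show ?thesis
      by (simp add: M2_simps)
  qed
  finally show ?thesis
    by (rule mat_op_inject[rotated 2]) (simp_all add: exp_i_def mat_exp_def pauli_Z_def)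
qed

lemma gate_mat_carrier [simp]: "valid_gate n g \<Longrightarrow> gate_mat n g \<in> carrier_mat (2 ^ n) (2 ^ n)"
  by (cases g) (auto simp: M2_ketbra pauli_X_def exp_i_pauli_Z intro!: add_carrier_mat mult_carrier_mat[of _ "2 ^ n" "2 ^ n"])

lemma valid_circuit_simps [simp]:
  "valid_circuit n []" "valid_circuit n (g # gs) \<longleftrightarrow> valid_gate n g \<and> valid_circuit n gs"
  "valid_circuit n (gs @ hs) \<longleftrightarrow> valid_circuit n gs \<and> valid_circuit n hs"
  by (auto simp: valid_circuit_def)

lemma T_count_simps [simp]:
  "T_count [] = 0" "T_count (g # gs) = (if is_T g then 1 else 0) + T_count gs"
  "T_count (gs @ hs) = T_count gs + T_count hs"
  by (auto simp: T_count_def)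

lemma rotation_count_simps [simp]:
  "rotation_count [] = 0" "rotation_count (g # gs) = (if is_rotation g then 1 else 0) + rotation_count gs"
  "rotation_count (gs @ hs) = rotation_count gs + rotation_count hs"
  by (auto simp: rotation_count_def)

lemma circuit_mat_carrier [simp]: "valid_circuit n gs \<Longrightarrow> circuit_mat n gs \<in> carrier_mat (2 ^ n) (2 ^ n)"
  by (induction gs) auto

lemma circuit_op_Nil [simp]: "circuit_op n [] = 1"
  by (simp add: circuit_op_def mat_op_one)

lemma circuit_op_Cons:
  "valid_gate n g \<Longrightarrow> valid_circuit n gs \<Longrightarrow> circuit_op n (g # gs) = circuit_op n gs * qop n (gate_mat n g)"
  by (simp add: circuit_op_def mat_op_mult)

lemma circuit_op_append:
  "valid_circuit n gs \<Longrightarrow> valid_circuit n hs \<Longrightarrow> circuit_op n (gs @ hs) = circuit_op n hs * circuit_op n gs"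
  by (induction gs) (auto simp: circuit_op_Cons mult.assoc)

lemma scalar_op_commute_circuit:
  "valid_circuit n gs \<Longrightarrow> scalar_op n c * circuit_op n gs = circuit_op n gs * scalar_op n c"
  unfolding circuit_op_def by (rule scalar_op_commute) simp

text \<open>The cost estimate runs through this predicate: phases commute with circuits, so products
  are again of this form and both bounds add up.\<close>

definition implements :: "nat \<Rightarrow> nat \<Rightarrow> nat \<Rightarrow> seq_op \<Rightarrow> bool" where
  "implements n a b U \<longleftrightarrow> (\<exists>gs \<phi>. valid_circuit n gs \<and> U = scalar_op n (cis \<phi>) * circuit_op n gs \<and>
     T_count gs \<le> a \<and> rotation_count gs \<le> b)"

lemma implements_one: "implements n 0 0 1"
  unfolding implements_def by (intro exI[of _ "[]"] exI[of _ 0]) simp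

lemma implements_mult:
  assumes "implements n a b U" "implements n a' b' V"
  shows "implements n (a + a') (b + b') (U * V)"
proof -
  obtain gs \<phi> hs \<psi> where
    U: "valid_circuit n gs" "U = scalar_op n (cis \<phi>) * circuit_op n gs" "T_count gs \<le> a" "rotation_count gs \<le> b" and
    V: "valid_circuit n hs" "V = scalar_op n (cis \<psi>) * circuit_op n hs" "T_count hs \<le> a'" "rotation_count hs \<le> b'"
    using assms by (auto simp: implements_def)
  have "U * V = scalar_op n (cis \<phi>) * (circuit_op n gs * scalar_op n (cis \<psi>)) * circuit_op n hs"
    by (simp add: U(2) V(2) mult.assoc)
  also have "\<dots> = (scalar_op n (cis \<phi>) * scalar_op n (cis \<psi>)) * (circuit_op n gs * circuit_op n hs)"
    by (simp add: mult.assoc flip: scalar_op_commute_circuit[OF U(1)])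
  \<comment> \<open>The head of a list acts first, so the circuit of the right factor comes
    first.\<close>
  also have "\<dots> = scalar_op n (cis (\<phi> + \<psi>)) * circuit_op n (hs @ gs)"
    by (simp add: scalar_op_mult cis_mult circuit_op_append U(1) V(1))
  finally show ?thesis
    unfolding implements_def using U V
    by (intro exI[of _ "hs @ gs"] exI[of _ "\<phi> + \<psi>"]) auto
qed

text \<open>The inverse V is carried along with a circuit of its own, so that inverting means
  swapping the pair. Both equalities with circuits are exact, without a phase.\<close>

definition clifford :: "nat \<Rightarrow> seq_op \<Rightarrow> seq_op \<Rightarrow> bool" where
  "clifford n U V \<longleftrightarrow> U * V = 1 \<and> V * U = 1 \<and>
    (\<exists>gs. valid_circuit n gs \<and> T_count gs = 0 \<and> rotation_count gs = 0 \<and> U = circuit_op n gs) \<and>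
    (\<exists>gs. valid_circuit n gs \<and> T_count gs = 0 \<and> rotation_count gs = 0 \<and> V = circuit_op n gs)"

lemma clifford_sym: "clifford n U V \<Longrightarrow> clifford n V U"
  by (auto simp: clifford_def)

lemma clifford_one: "clifford n 1 1"
  by (auto simp: clifford_def intro!: exI[of _ "[]"])

lemma clifford_mult:
  assumes "clifford n U V" "clifford n U' V'"
  shows "clifford n (U * U') (V' * V)"
proof -
  have "U * U' * (V' * V) = U * (U' * V') * V" "V' * V * (U * U') = V' * (V * U) * U'"
    by (simp_all only: mult.assoc)
  then have "U * U' * (V' * V) = 1" "V' * V * (U * U') = 1"
    using assms by (simp_all add: clifford_def)
  moreover have "\<exists>gs. valid_circuit n gs \<and> T_count gs = 0 \<and> rotation_count gs = 0 \<and>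
      circuit_op n gs2 * circuit_op n gs1 = circuit_op n gs"
    if "valid_circuit n gs1 \<and> T_count gs1 = 0 \<and> rotation_count gs1 = 0"
      "valid_circuit n gs2 \<and> T_count gs2 = 0 \<and> rotation_count gs2 = 0" for gs1 gs2
    using that by (intro exI[of _ "gs1 @ gs2"]) (auto simp: circuit_op_append)
  ultimately show ?thesis
    using assms unfolding clifford_def by metis
qed

lemma clifford_implements: "clifford n U V \<Longrightarrow> implements n 0 0 U"
  by (auto simp: clifford_def implements_def intro!: exI[of _ 0])

lemma clifford_hadamard:
  assumes "q < n"
  shows "clifford n (site_op n q (complex_of_real (1 / sqrt 2) \<cdot>\<^sub>m M2 1 1 1 (- 1)))
    (site_op n q (complex_of_real (1 / sqrt 2) \<cdot>\<^sub>m M2 1 1 1 (- 1)))" (is "clifford n ?H ?H")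
proof -
  have "complex_of_real (sqrt 2) * complex_of_real (sqrt 2) = 2"
    by (metis abs_numeral of_real_mult of_real_numeral real_sqrt_abs2 real_sqrt_mult_self)
  then have "?H * ?H = site_op n q (1\<^sub>m 2)"
    by (simp add: site_op_mult M2_simps field_simps)
  then have "?H * ?H = 1"
    by (simp add: site_op_one)
  moreover have "?H = circuit_op n [Hadamard q]"
    using assms by (simp add: circuit_op_Cons qop_on_qubit)
  ultimately show ?thesis
    using assms unfolding clifford_def by (intro conjI exI[of _ "[Hadamard q]"]) auto
qed

lemma clifford_phase:
  assumes "q < n"
  shows "clifford n (site_op n q (M2 1 0 0 \<i>)) (site_op n q (M2 1 0 0 (- \<i>)))"
proof -
  \<comment> \<open>The phase gate has order 4, so its cube is its inverse.\<close>
  let ?g = "[PhaseGate q, PhaseGate q, PhaseGate q]"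
  have "site_op n q (M2 1 0 0 \<i>) * site_op n q (M2 1 0 0 (- \<i>)) = site_op n q (1\<^sub>m 2)"
    "site_op n q (M2 1 0 0 (- \<i>)) * site_op n q (M2 1 0 0 \<i>) = site_op n q (1\<^sub>m 2)"
    by (simp_all add: site_op_mult M2_simps)
  moreover have "site_op n q (M2 1 0 0 \<i>) = circuit_op n [PhaseGate q]"
    using assms by (simp add: circuit_op_Cons qop_on_qubit)
  moreover have "site_op n q (M2 1 0 0 (- \<i>)) = circuit_op n ?g"
    using assms by (simp add: circuit_op_Cons qop_on_qubit site_op_mult M2_simps)
  ultimately show ?thesis
    using assms unfolding clifford_def site_op_one
    by (intro conjI exI[of _ "[PhaseGate q]"] exI[of _ ?g]) simp_all
qed

text \<open>Let p and p' project onto control 0 and 1, and let x and z be X and Z on the target.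
  Then U = p + p' x, and U z U = p z + p' x z x = (p - p') z, where p - p' is Z on the
  control.\<close>

lemma clifford_CNOT:
  assumes "c < n" "t < n" "c \<noteq> t"
  defines "U \<equiv> site_op n c (ketbra 0 0) + site_op n c (ketbra (Suc 0) (Suc 0)) * site_op n t pauli_X"
  shows "clifford n U U" "U * site_op n t pauli_Z * U = site_op n c pauli_Z * site_op n t pauli_Z"
proof -
  define p p' x z where "p = site_op n c (ketbra 0 0)" and "p' = site_op n c (ketbra (Suc 0) (Suc 0))"
    and "x = site_op n t pauli_X" and "z = site_op n t pauli_Z"
  have carr: "ketbra 0 0 \<in> carrier_mat 2 2" "ketbra (Suc 0) (Suc 0) \<in> carrier_mat 2 2"
    "pauli_X \<in> carrier_mat 2 2" "pauli_Z \<in> carrier_mat 2 2"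
    by (simp_all add: ketbra_def pauli_X_def pauli_Z_def)
  have zero: "site_op n c (M2 0 0 0 0) = 0"
    using site_op_scaleR[of c n "M2 0 0 0 0" 0] assms by (simp add: M2_simps)
  have p: "p * p = p" "p' * p' = p'" "p * p' = 0" "p' * p = 0"
    unfolding p_def p'_def by (simp_all add: site_op_mult carr zero) (simp_all add: M2_simps zero)
  have "p + p' = site_op n c (ketbra 0 0 + ketbra (Suc 0) (Suc 0))"
    unfolding p_def p'_def using assms carr by (simp add: site_op_add)
  also have "ketbra 0 0 + ketbra (Suc 0) (Suc 0) = 1\<^sub>m 2"
    by (simp add: M2_simps)
  finally have p1: "p + p' = 1"
    by (simp add: site_op_one)
  have "site_op n c pauli_Z = site_op n c (ketbra 0 0 + - ketbra (Suc 0) (Suc 0))"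
    by (simp add: M2_simps)
  also have "\<dots> = p - p'"
    unfolding p_def p'_def using assms carr by (subst site_op_add) (auto simp: site_op_uminus)
  finally have pz: "site_op n c pauli_Z = p - p'" .
  have comm: "x * p = p * x" "x * p' = p' * x" "z * p = p * z" "z * p' = p' * z"
    unfolding p_def p'_def x_def z_def using assms carr by (simp_all add: site_op_commute)
  have "x * x = site_op n t (1\<^sub>m 2)"
    unfolding x_def by (simp add: site_op_mult carr) (simp add: M2_simps)
  then have xx: "x * x = 1" by (simp add: site_op_one)
  have "x * z = site_op n t (- (pauli_Z * pauli_X))"
    unfolding x_def z_def by (simp add: site_op_mult carr) (simp add: M2_simps)
  then have xz: "x * z = - (z * x)"
    unfolding x_def z_def using assms carr by (simp add: site_op_mult site_op_uminus)
  \<comment> \<open>Versions with a trailing factor y, by which right-nested products are brought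
    into the order projection, z, x.\<close>
  have a: "x * (p * y) = p * (x * y)" "x * (p' * y) = p' * (x * y)" "z * (p * y) = p * (z * y)" 
    "z * (p' * y) = p' * (z * y)" "x * (x * y) = y" "x * (z * y) = - (z * (x * y))"
    "p * (p * y) = p * y" "p' * (p' * y) = p' * y" "p * (p' * y) = 0" "p' * (p * y) = 0" for y
    by (metis comm(1) mult.assoc, metis comm(2) mult.assoc, metis comm(3) mult.assoc, metis comm(4) mult.assoc,
        metis xx mult.assoc mult_1, metis xz mult.assoc mult_minus_left,
        metis p(1) mult.assoc, metis p(2) mult.assoc, metis p(3) mult.assoc mult_zero_left,
        metis p(4) mult.assoc mult_zero_left)
  have U: "U = p + p' * x"
    unfolding U_def p_def p'_def x_def ..
  have "U * U = p + p'"
    unfolding U by (simp add: algebra_simps comm p xx a)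
  then have UU: "U * U = 1" by (simp add: p1)
  show "U * site_op n t pauli_Z * U = site_op n c pauli_Z * site_op n t pauli_Z"
    unfolding U pz z_def[symmetric] by (simp add: algebra_simps comm p xx xz a)
  have "qop n (gate_mat n (CNOT c t)) = U"
    unfolding U_def gate_mat.simps using assms(1-3) carr
    by (subst mat_op_add) (auto simp: mat_op_mult qop_on_qubit intro: mult_carrier_mat[of _ "2 ^ n" "2 ^ n"])
  then have "U = circuit_op n [CNOT c t]"
    using assms(1-3) by (simp add: circuit_op_Cons)
  with UU show "clifford n U U"
    using assms(1-3) unfolding clifford_def by (intro conjI exI[of _ "[CNOT c t]"]) auto
qed

section \<open>Generators of Pauli rotations\<close>

definition Z_generator :: "nat \<Rightarrow> nat \<Rightarrow> seq_op" where
  "Z_generator n q = site_op n q (M2 \<i> 0 0 (- \<i>))"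

text \<open>In Pauli language these are the operators \<open>\<i> P\<close> with \<open>P\<close> Clifford-conjugate to some
  \<open>Z\<^sub>q\<close>. Working with the anti-Hermitian \<open>\<i> P\<close> keeps all rotations inside a real algebra.\<close>

definition generator :: "nat \<Rightarrow> seq_op \<Rightarrow> bool" where
  "generator n A \<longleftrightarrow> (\<exists>q U V. q < n \<and> clifford n U V \<and> A = U * Z_generator n q * V)"

lemma Z_generator_square: "Z_generator n q * Z_generator n q = - 1" if "q < n"
proof -
  have "Z_generator n q * Z_generator n q = site_op n q (- (1\<^sub>m 2))"
    unfolding Z_generator_def by (simp add: site_op_mult) (simp add: M2_simps)
  then show ?thesis
    using that by (simp add: site_op_uminus site_op_one)
qed

lemma exp_Z_generator:
  assumes "q < n"
  shows "exp (x *\<^sub>R Z_generator n q) = site_op n q (M2 (cis x) 0 0 (cis (- x)))"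
proof -
  have "exp (x *\<^sub>R Z_generator n q) = cos x *\<^sub>R site_op n q (1\<^sub>m 2) + sin x *\<^sub>R Z_generator n q"
    unfolding exp_scaleR_sqrt_minus_one[OF Z_generator_square[OF assms]] by (simp add: site_op_one)
  also have "\<dots> = site_op n q (complex_of_real (cos x) \<cdot>\<^sub>m 1\<^sub>m 2 + complex_of_real (sin x) \<cdot>\<^sub>m M2 \<i> 0 0 (- \<i>))"
    unfolding Z_generator_def by (subst site_op_add) (use assms in \<open>simp_all add: site_op_scaleR\<close>)
  also have "complex_of_real (cos x) \<cdot>\<^sub>m 1\<^sub>m 2 + complex_of_real (sin x) \<cdot>\<^sub>m M2 \<i> 0 0 (- \<i>) =
      M2 (cis x) 0 0 (cis (- x))"
  proof -
    have "complex_of_real (cos x) + complex_of_real (sin x) * \<i> = cis x"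
      "complex_of_real (cos x) + - (complex_of_real (sin x) * \<i>) = cis (- x)"
      by (simp_all add: complex_eq_iff)
    then show ?thesis
      by (simp add: M2_simps)
  qed
  finally show ?thesis .
qed

lemma implements_gate:
  assumes "valid_gate n g" "X = scalar_op n (cis \<phi>) * qop n (gate_mat n g)"
    "(if is_T g then 1 else 0) \<le> a" "(if is_rotation g then 1 else 0) \<le> b"
  shows "implements n a b X"
  unfolding implements_def using assms
  by (intro exI[of _ "[g]"] exI[of _ \<phi>]) (simp add: circuit_op_Cons)

text \<open>The diagonal matrix with entries \<open>cis (pi / 8)\<close> and
  \<open>cis (- pi / 8)\<close> is \<open>cis (pi / 8)\<close> times the inverse T-gate; the
  opposite angle gives the T-gate itself.\<close>

lemma implements_exp_Z_generator:
  assumes "q < n"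
  shows "implements n 0 1 (exp (x *\<^sub>R Z_generator n q))"
    "implements n 1 0 (exp ((pi / 8) *\<^sub>R Z_generator n q))"
    "implements n 1 0 (exp (- (pi / 8) *\<^sub>R Z_generator n q))"
proof -
  show "implements n 0 1 (exp (x *\<^sub>R Z_generator n q))"
    using assms by (intro implements_gate[of n "ZRotation x q" _ 0])
      (simp_all add: exp_Z_generator exp_i_pauli_Z qop_on_qubit)
  have "exp ((pi / 8) *\<^sub>R Z_generator n q) =
      scalar_op n (cis (pi / 8)) * qop n (gate_mat n (TInverse q))"
    using assms by (simp add: exp_Z_generator qop_on_qubit M2_smult cis_mult flip: site_op_smult)
  then show "implements n 1 0 (exp ((pi / 8) *\<^sub>R Z_generator n q))"
    using assms by (intro implements_gate[of n "TInverse q" _ "pi / 8"]) simp_all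
  have "exp (- (pi / 8) *\<^sub>R Z_generator n q) =
      scalar_op n (cis (- pi / 8)) * qop n (gate_mat n (TGate q))"
    using assms by (simp only: exp_Z_generator) (simp add: qop_on_qubit M2_smult cis_mult flip: site_op_smult)
  then show "implements n 1 0 (exp (- (pi / 8) *\<^sub>R Z_generator n q))"
    using assms by (intro implements_gate[of n "TGate q" _ "- pi / 8"]) simp_all
qed

lemma implements_conjugate:
  assumes "clifford n U V" "implements n a b X"
  shows "implements n a b (U * X * V)"
  using implements_mult[OF implements_mult[OF clifford_implements[OF assms(1)] assms(2)]
      clifford_implements[OF clifford_sym[OF assms(1)]]] by simp

lemma exp_scaleR_conjugate:
  assumes "clifford n U V"
  shows "exp (x *\<^sub>R (U * A * V)) = U * exp (x *\<^sub>R A) * V"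
  using exp_conjugate[of V U "x *\<^sub>R A"] assms by (simp add: clifford_def)

lemma implements_exp_generator:
  assumes "generator n A"
  shows "implements n 0 1 (exp (x *\<^sub>R A))" "implements n 1 0 (exp ((pi / 8) *\<^sub>R A))"
    "implements n 1 0 (exp (- (pi / 8) *\<^sub>R A))"
  using assms unfolding generator_def
  by (auto simp only: exp_scaleR_conjugate intro!: implements_conjugate implements_exp_Z_generator)

lemma generator_conjugate:
  assumes "generator n A" "clifford n U V"
  shows "generator n (U * A * V)"
proof -
  obtain q U' V' where "q < n" "clifford n U' V'" "A = U' * Z_generator n q * V'"
    using assms(1) by (auto simp: generator_def)
  then show ?thesis
    using clifford_mult[OF assms(2)] unfolding generator_def by (metis mult.assoc)
qed

lemma generator_Z_generator: "q < n \<Longrightarrow> generator n (Z_generator n q)"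
  unfolding generator_def by (intro exI[of _ q] exI[of _ 1]) (simp add: clifford_one)

lemma generator_square: "generator n A \<Longrightarrow> A * A = - 1"
proof -
  assume "generator n A"
  then obtain q U V where A: "q < n" "U * V = 1" "V * U = 1" "A = U * Z_generator n q * V"
    by (auto simp: generator_def clifford_def)
  have "A * A = U * (Z_generator n q * (V * U) * Z_generator n q) * V"
    by (simp only: A(4) mult.assoc)
  with A show ?thesis
    by (simp add: Z_generator_square)
qed

text \<open>A rotation by \<open>\<pi>/4\<close> is a phase gate up to conjugation and a scalar, and conjugating
  \<open>B\<close> with the one generated by \<open>A\<close> gives \<open>A * B\<close>.\<close>

lemma generator_mult:
  assumes A: "generator n A" and B: "generator n B" and AB: "B * A = - (A * B)"
  shows "generator n (A * B)"
proof -
  obtain q U V where q: "q < n" and UV: "clifford n U V" and AZ: "A = U * Z_generator n q * V"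
    using A by (auto simp: generator_def)
  \<comment> \<open>The constants that normalise the phase gate and its inverse: c (1 - i) = 1 and c
    (1 + i) = i, and the complex conjugate equations for d.\<close>
  define c d where "c = (1 + \<i>) / 2" and "d = (1 - \<i>) / 2"
  let ?S = "site_op n q (M2 1 0 0 \<i>)" and ?S' = "site_op n q (M2 1 0 0 (- \<i>))"
  have "M2 1 0 0 \<i> = c \<cdot>\<^sub>m (1\<^sub>m 2 + - M2 \<i> 0 0 (- \<i>))" "M2 1 0 0 (- \<i>) = d \<cdot>\<^sub>m (1\<^sub>m 2 + M2 \<i> 0 0 (- \<i>))"
    by (simp_all add: M2_simps c_def d_def field_simps)
  then have S: "?S = scalar_op n c * (1 - Z_generator n q)" "?S' = scalar_op n d * (1 + Z_generator n q)"
    using q by (simp_all add: site_op_smult site_op_add site_op_uminus site_op_one Z_generator_def)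
  have commU: "scalar_op n x * U = U * scalar_op n x" "scalar_op n x * V = V * scalar_op n x" for x
    using UV by (auto simp: clifford_def scalar_op_commute_circuit)
  have commA: "scalar_op n x * X = X * scalar_op n x" if gX: "generator n X" for x X
  proof -
    obtain r W W' where r: "r < n" "clifford n W W'" "X = W * Z_generator n r * W'"
      using gX by (auto simp: generator_def)
    moreover have "scalar_op n x * W = W * scalar_op n x" "scalar_op n x * W' = W' * scalar_op n x"
      using r(2) by (auto simp: clifford_def scalar_op_commute_circuit)
    moreover have "scalar_op n x * Z_generator n r = Z_generator n r * scalar_op n x"
      unfolding Z_generator_def using r(1) by (intro scalar_op_commute_site) auto
    ultimately show ?thesis
      by (metis mult.assoc)
  qed
  have inv: "U * V = 1" "U * (V * x) = x" for x
    using UV by (auto simp: clifford_def simp flip: mult.assoc)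
  have "U * ?S * V = scalar_op n c * (U * (1 - Z_generator n q) * V)"
    "U * ?S' * V = scalar_op n d * (U * (1 + Z_generator n q) * V)"
    unfolding S by (metis commU(1) mult.assoc)+
  then have conj: "U * ?S * V = scalar_op n c * (1 - A)" "U * ?S' * V = scalar_op n d * (1 + A)"
    by (simp_all add: algebra_simps inv AZ)
  have "clifford n (U * (?S' * V)) (U * ?S * V)"
    using clifford_mult[OF UV clifford_mult[OF clifford_sym[OF clifford_phase[OF q]] clifford_sym[OF UV]]]
    by (simp add: mult.assoc)
  from generator_conjugate[OF B this] have "generator n ((U * ?S' * V) * B * (U * ?S * V))"
    by (simp add: mult.assoc)
  also have "(U * ?S' * V) * B * (U * ?S * V) = scalar_op n d * ((1 + A) * B * scalar_op n c) * (1 - A)"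
    unfolding conj by (simp add: mult.assoc)
  also have "(1 + A) * B * scalar_op n c = scalar_op n c * ((1 + A) * B)"
    by (simp add: algebra_simps commA[OF A] commA[OF B]) (metis commA[OF A] commA[OF B] mult.assoc)
  also have "scalar_op n d * (scalar_op n c * ((1 + A) * B)) * (1 - A) = scalar_op n (d * c) * ((1 + A) * B * (1 - A))"
    by (simp add: scalar_op_mult flip: mult.assoc)
  \<comment> \<open>In B + A B - B A - A B A the anticommutation doubles A B, while A B A = - A A B
    = B cancels the first term. The 2 is then absorbed by d c = 1/2.\<close>
  also have "(1 + A) * B * (1 - A) = 2 *\<^sub>R (A * B)"
  proof -
    have "A * B * A = B"
      by (simp add: mult.assoc AB) (simp add: generator_square[OF A] flip: mult.assoc)
    then show ?thesis
      by (simp add: algebra_simps AB scaleR_2)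
  qed
  also have "d * c = complex_of_real (1 / 2)"
    by (simp add: c_def d_def algebra_simps)
  also have "scalar_op n (complex_of_real (1 / 2)) * 2 *\<^sub>R (A * B) = A * B"
    by (simp only: scalar_op_of_real) simp
  finally show ?thesis .
qed

lemma hadamard_conjugate:
  assumes "q < n"
  shows "site_op n q (complex_of_real (1 / sqrt 2) \<cdot>\<^sub>m M2 1 1 1 (- 1)) * site_op n q pauli_Z *
    site_op n q (complex_of_real (1 / sqrt 2) \<cdot>\<^sub>m M2 1 1 1 (- 1)) = site_op n q pauli_X"
proof -
  have "complex_of_real (sqrt 2) * complex_of_real (sqrt 2) = 2"
    by (metis abs_numeral of_real_mult of_real_numeral real_sqrt_abs2 real_sqrt_mult_self)
  then show ?thesis
    by (simp add: site_op_mult M2_simps field_simps)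
qed

lemma Z_generator_altdef: "q < n \<Longrightarrow> Z_generator n q = scalar_op n \<i> * site_op n q pauli_Z"
  unfolding Z_generator_def by (subst site_op_smult[symmetric]) (simp_all add: M2_simps)

lemma pauli_carrier [simp]: "pauli_X \<in> carrier_mat 2 2" "pauli_Z \<in> carrier_mat 2 2"
  by (simp_all add: M2_simps)

lemma conjugate_central:
  fixes c u v z :: "'a::semigroup_mult"
  assumes "c * u = u * c"
  shows "u * (c * z) * v = c * (u * z * v)"
  using assms by (metis mult.assoc)

lemma generator_ZZ:
  assumes "c < n" "t < n" "c \<noteq> t"
  shows "generator n (scalar_op n \<i> * (site_op n c pauli_Z * site_op n t pauli_Z))"
proof -
  let ?U = "site_op n c (ketbra 0 0) + site_op n c (ketbra (Suc 0) (Suc 0)) * site_op n t pauli_X"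
  have "scalar_op n \<i> * ?U = ?U * scalar_op n \<i>"
    using clifford_CNOT(1)[OF assms] by (auto simp: clifford_def scalar_op_commute_circuit)
  then have "?U * Z_generator n t * ?U = scalar_op n \<i> * (?U * site_op n t pauli_Z * ?U)"
    unfolding Z_generator_altdef[OF assms(2)] by (rule conjugate_central)
  with generator_conjugate[OF generator_Z_generator[OF assms(2)] clifford_CNOT(1)[OF assms]] show ?thesis
    by (simp only: clifford_CNOT(2)[OF assms])
qed

text \<open>Hadamard gates on both qubits turn Z Z into X X.\<close>

lemma generator_XX:
  assumes "c < n" "t < n" "c \<noteq> t"
  shows "generator n (scalar_op n \<i> * (site_op n c pauli_X * site_op n t pauli_X))"
proof -
  define h where "h = complex_of_real (1 / sqrt 2) \<cdot>\<^sub>m M2 1 1 1 (- 1)"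
  have h: "h \<in> carrier_mat 2 2" by (simp add: h_def)
  let ?C = "site_op n c h" and ?T = "site_op n t h"
  have cl: "clifford n ?C ?C" "clifford n ?T ?T"
    unfolding h_def using assms by (blast intro: clifford_hadamard)+
  have "generator n (?T * (?C * (scalar_op n \<i> * (site_op n c pauli_Z * site_op n t pauli_Z)) * ?C) * ?T)"
    by (intro generator_conjugate generator_ZZ cl assms)
  also have "?T * (?C * (scalar_op n \<i> * (site_op n c pauli_Z * site_op n t pauli_Z)) * ?C) * ?T =
    scalar_op n \<i> * (?T * (?C * (site_op n c pauli_Z * site_op n t pauli_Z) * ?C) * ?T)"
    by (simp only: conjugate_central scalar_op_commute_site[OF assms(1) h] scalar_op_commute_site[OF assms(2) h])
  also have "?T * (?C * (site_op n c pauli_Z * site_op n t pauli_Z) * ?C) * ?T =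
    (?C * site_op n c pauli_Z * ?C) * (?T * site_op n t pauli_Z * ?T)"
  proof -
    have TC: "?T * ?C = ?C * ?T" "?T * site_op n c pauli_Z = site_op n c pauli_Z * ?T"
      "site_op n t pauli_Z * ?C = ?C * site_op n t pauli_Z"
      using assms h by (simp_all add: site_op_commute)
    have "?T * (?C * (site_op n c pauli_Z * site_op n t pauli_Z) * ?C) * ?T =
        (?T * ?C) * site_op n c pauli_Z * (site_op n t pauli_Z * ?C) * ?T"
      by (simp only: mult.assoc)
    also have "\<dots> = ?C * (?T * site_op n c pauli_Z) * ?C * (site_op n t pauli_Z * ?T)"
      by (simp only: TC(1,3) mult.assoc)
    also have "\<dots> = ?C * site_op n c pauli_Z * (?T * ?C) * (site_op n t pauli_Z * ?T)"
      by (simp only: TC(2) mult.assoc)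
    also have "\<dots> = (?C * site_op n c pauli_Z * ?C) * (?T * site_op n t pauli_Z * ?T)"
      by (simp only: TC(1) mult.assoc)
    finally show ?thesis .
  qed
  finally show ?thesis
    unfolding h_def hadamard_conjugate[OF assms(1)] hadamard_conjugate[OF assms(2)] .
qed

text \<open>With z the generator of qubit q, x = i X is a generator anticommuting with z. Two uses
  of \<open>generator_mult\<close> make x (x z) a generator, and this is -z because x squares to -1.
  Conjugation carries the result over to A.\<close>

lemma generator_uminus:
  assumes "generator n A"
  shows "generator n (- A)"
proof -
  obtain q U V where A: "q < n" "clifford n U V" "A = U * Z_generator n q * V"
    using assms by (auto simp: generator_def)
  define h where "h = complex_of_real (1 / sqrt 2) \<cdot>\<^sub>m M2 1 1 1 (- 1)"
  have h: "h \<in> carrier_mat 2 2" by (simp add: h_def)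
  define x where "x = scalar_op n \<i> * site_op n q pauli_X"
  have "site_op n q h * Z_generator n q * site_op n q h = x"
    unfolding Z_generator_altdef[OF A(1)] x_def hadamard_conjugate[OF A(1), symmetric] h_def[symmetric]
    by (rule conjugate_central[OF scalar_op_commute_site[OF A(1) h]])
  then have gx: "generator n x"
    using generator_conjugate[OF generator_Z_generator[OF A(1)] clifford_hadamard[OF A(1)]]
    by (simp add: h_def)
  have "x = site_op n q (\<i> \<cdot>\<^sub>m pauli_X)"
    unfolding x_def using A(1) by (simp add: site_op_smult)
  then have "Z_generator n q * x = site_op n q (- (\<i> \<cdot>\<^sub>m pauli_X * M2 \<i> 0 0 (- \<i>)))"
    "x * Z_generator n q = site_op n q (\<i> \<cdot>\<^sub>m pauli_X * M2 \<i> 0 0 (- \<i>))"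
    unfolding Z_generator_def by (simp_all add: site_op_mult) (simp add: M2_simps)
  then have anti: "Z_generator n q * x = - (x * Z_generator n q)"
    using A(1) by (simp add: site_op_uminus mult_carrier_mat[of _ 2 2])
  have "generator n (x * Z_generator n q)"
    using anti by (intro generator_mult gx generator_Z_generator A(1))
  from generator_mult[OF gx this] have "generator n (x * (x * Z_generator n q))"
    using anti by (simp add: mult.assoc)
  then have "generator n (- Z_generator n q)"
    by (simp add: generator_square[OF gx] flip: mult.assoc)
  from generator_conjugate[OF this A(2)] show ?thesis
    by (simp add: A(3))
qed

text \<open>Commuting summands turn the exponential into a product, and the costs of its factors add
  up.\<close>

lemma implements_exp_sum:
  assumes "finite S" "\<And>x. x \<in> S \<Longrightarrow> implements n a b (exp (f x))"
    "\<And>x y. x \<in> S \<Longrightarrow> y \<in> S \<Longrightarrow> f x * f y = f y * f x"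
  shows "implements n (card S * a) (card S * b) (exp (sum f S))"
  using assms
proof (induction S)
  case empty
  then show ?case by (simp add: implements_one)
next
  case (insert x S)
  have "f x * sum f S = sum f S * f x"
    unfolding sum_distrib_left sum_distrib_right using insert.prems by (intro sum.cong) auto
  then have "exp (sum f (insert x S)) = exp (f x) * exp (sum f S)"
    using insert.hyps by (simp add: exp_add_commuting)
  with implements_mult[OF insert.prems(1)[of x] insert.IH] insert show ?case
    by simp
qed

section \<open>Majorana operators\<close>

definition pauli_Y :: "complex mat" where
  "pauli_Y = M2 0 (- \<i>) \<i> 0"

definition jw_string :: "nat \<Rightarrow> complex mat \<Rightarrow> nat \<Rightarrow> complex mat" where
  "jw_string k U j = (if j < k then pauli_Z else if j = k then U else 1\<^sub>m 2)"

text \<open>Indices 2 k and 2 k + 1 hold the two Majorana operators of position k, the strings Z...Z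
  X and Z...Z Y. In this numbering the product of consecutive operators acts on at most two qubits,
  since the common strings cancel.\<close>

definition majorana :: "nat \<Rightarrow> nat \<Rightarrow> seq_op" where
  "majorana n m = tensor_op n (jw_string (m div 2) (if even m then pauli_X else pauli_Y))"

lemma mat2_jw_string [simp]: "U \<in> carrier_mat 2 2 \<Longrightarrow> mat2 (jw_string k U)"
  by (auto simp: mat2_def jw_string_def)

lemma pauli_Y_carrier [simp]: "pauli_Y \<in> carrier_mat 2 2"
  by (simp add: pauli_Y_def)

lemma majorana_square: "majorana n m * majorana n m = 1"
  unfolding majorana_def by (subst tensor_op_mult) (auto simp: jw_string_def M2_simps pauli_Y_def intro!: tensor_op_one)

text \<open>At qubit \<open>i div 2\<close> the factors are X or Y against Z, or X against Y if both
  operators belong to the same position. At every other qubit they commute.\<close>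

lemma majorana_anticommute_less:
  assumes "i < j" "j < 2 * n"
  shows "majorana n i * majorana n j = - (majorana n j * majorana n i)"
proof -
  have "i div 2 < j div 2 \<or> i div 2 = j div 2 \<and> even i \<and> odd j"
    using assms(1) by presburger
  then show ?thesis
    unfolding majorana_def using assms
    by (intro tensor_op_anticommute[of _ _ "i div 2"]) (auto simp: jw_string_def M2_simps pauli_Y_def)
qed

lemma majorana_anticommute:
  "i \<noteq> j \<Longrightarrow> i < 2 * n \<Longrightarrow> j < 2 * n \<Longrightarrow> majorana n i * majorana n j = - (majorana n j * majorana n i)"
  using majorana_anticommute_less[of i j n] majorana_anticommute_less[of j i n] by (cases "i < j") auto

lemma majorana_even_odd: "k < n \<Longrightarrow> majorana n (2 * k) * majorana n (Suc (2 * k)) = Z_generator n k"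
  unfolding majorana_def Z_generator_def site_op_def
  by (subst tensor_op_mult)
    (auto simp: jw_string_def on_site_def M2_simps pauli_Y_def intro!: tensor_op_cong)

text \<open>At qubit k the product is Y Z = i X and at the next one X; the earlier Z factors
  cancel.\<close>

lemma majorana_odd_even:
  assumes "Suc k < n"
  shows "majorana n (Suc (2 * k)) * majorana n (Suc (Suc (2 * k))) =
    scalar_op n \<i> * (site_op n k pauli_X * site_op n (Suc k) pauli_X)"
proof -
  have "tensor_op n (\<lambda>j. jw_string k pauli_Y j * jw_string (Suc k) pauli_X j) =
      scalar_op n \<i> * tensor_op n (\<lambda>j. on_site k pauli_X j * on_site (Suc k) pauli_X j)"
    using assms by (intro tensor_op_smult[of _ k])
      (auto simp: mat2_def jw_string_def on_site_def M2_simps pauli_Y_def)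
  then show ?thesis
    unfolding majorana_def site_op_def by (simp add: tensor_op_mult)
qed

lemma generator_majorana_Suc:
  assumes "Suc m < 2 * n"
  shows "generator n (majorana n m * majorana n (Suc m))"
proof (cases "even m")
  case True
  then obtain k where "m = 2 * k" by (elim evenE)
  then show ?thesis
    using assms by (simp add: majorana_even_odd generator_Z_generator)
next
  case False
  then obtain k where "m = Suc (2 * k)" by (elim oddE) auto
  then show ?thesis
    using assms by (simp add: majorana_odd_even generator_XX)
qed

text \<open>Induction on j through (a b) (b c) = a c: the first factor is a generator by induction,
  the second because b and c are consecutive, and the two anticommute because they share just b.
  This covers strings of any length.\<close>

lemma generator_majorana_less:
  "i < j \<Longrightarrow> j < 2 * n \<Longrightarrow> generator n (majorana n i * majorana n j)"
proof (induction j)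
  case (Suc j)
  show ?case
  proof (cases "i = j")
    case False
    let ?a = "majorana n i" and ?b = "majorana n j" and ?c = "majorana n (Suc j)"
    have 1: "(?a * ?b) * (?b * ?c) = ?a * ?c"
      by (metis majorana_square mult.assoc mult_1)
    have "(?b * ?c) * (?a * ?b) = ?b * (?b * (?c * ?a))"
    proof -
      have "?c * (?a * ?b) = ?b * (?c * ?a)"
        using majorana_anticommute[of i j n] majorana_anticommute[of "Suc j" j n] Suc.prems False
        by (simp add: mult.assoc) (simp flip: mult.assoc)
      then show ?thesis by (simp add: mult.assoc)
    qed
    also have "\<dots> = - (?a * ?c)"
      using majorana_anticommute[of "Suc j" i n] Suc.prems False
      by (simp add: majorana_square flip: mult.assoc)
    finally have "(?b * ?c) * (?a * ?b) = - ((?a * ?b) * (?b * ?c))"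
      by (simp add: 1)
    moreover have "generator n (?a * ?b)"
      using Suc False by simp
    ultimately show ?thesis
      using generator_mult[OF _ generator_majorana_Suc[OF Suc.prems(2)]] 1 by metis
  qed (use Suc.prems generator_majorana_Suc in auto)
qed simp

lemma generator_majorana:
  assumes "i \<noteq> j" "i < 2 * n" "j < 2 * n"
  shows "generator n (majorana n i * majorana n j)"
proof (cases "i < j")
  case False
  \<comment> \<open>Exchanging the two operators costs a sign, which is again absorbed by a
    generator.\<close>
  with assms show ?thesis
    using generator_uminus[OF generator_majorana_less[of j i n]] majorana_anticommute[OF assms] by simp
qed (use assms generator_majorana_less in auto)

lemma implements_exp_majorana_sums:
  assumes "distinct [p, q, r, s]" "set [p, q, r, s] \<subseteq> {..<2 * n}"
  shows "implements n 4 1 (exp (x *\<^sub>R ((1 / 2) *\<^sub>R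
    ((majorana n p + majorana n q) * (majorana n r + majorana n s)))))"
proof -
  note pq = implements_exp_generator[OF generator_majorana[of p q n]]
  note rs = implements_exp_generator[OF generator_majorana[of r s n]]
  note pr = implements_exp_generator[OF generator_majorana[of p r n]]
  \<comment> \<open>The four outer exponentials have angle pi/8 and cost a T-gate each; the middle
    one carries the free angle x and costs the rotation.\<close>
  have "implements n (1 + (1 + (0 + (1 + 1)))) (0 + (0 + (1 + (0 + 0))))
   (exp (- (pi / 8) *\<^sub>R (majorana n p * majorana n q)) * (exp (- (pi / 8) *\<^sub>R (majorana n r * majorana n s)) *
    (exp (x *\<^sub>R (majorana n p * majorana n r)) *
      (exp ((pi / 8) *\<^sub>R (majorana n r * majorana n s)) * exp ((pi / 8) *\<^sub>R (majorana n p * majorana n q))))))"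
    using assms by (intro implements_mult pq(2,3) rs(2,3) pr(1)) auto
  moreover have "exp (x *\<^sub>R ((1 / 2) *\<^sub>R
    ((majorana n p + majorana n q) * (majorana n r + majorana n s)))) =
    exp (- (pi / 8) *\<^sub>R (majorana n p * majorana n q)) * (exp (- (pi / 8) *\<^sub>R (majorana n r * majorana n s)) *
    (exp (x *\<^sub>R (majorana n p * majorana n r)) *
      (exp ((pi / 8) *\<^sub>R (majorana n r * majorana n s)) * exp ((pi / 8) *\<^sub>R (majorana n p * majorana n q)))))"
    using assms by (intro exp_product_of_sums majorana_square majorana_anticommute) auto
  ultimately show ?thesis
    by (simp add: numeral_eq_Suc)
qed

section \<open>The Hubbard Hamiltonian in Majorana operators\<close>

lemma even_product_commute:
  fixes a b c d :: "'a::ring_1"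
  assumes "c * a = - (a * c)" "c * b = - (b * c)" "d * a = - (a * d)" "d * b = - (b * d)"
  shows "(a * b) * (c * d) = (c * d) * (a * b)"
proof -
  have "c * (a * b) = (a * b) * c" "d * (a * b) = (a * b) * d"
    using assms by (simp_all flip: mult.assoc) (simp_all add: mult.assoc assms)
  then show ?thesis
    by (metis mult.assoc)
qed

text \<open>Here J stands for i, (g - J h) / 2 for a creation and (g' + J h') / 2 for an
  annihilation operator. In the sum of both orders the products of g with g' and of h with h' cancel
  by anticommutation, and the mixed ones are doubled.\<close>

lemma hopping_majorana:
  fixes J g h g' h' :: "'a::real_algebra_1"
  assumes J: "J * J = - 1" "J * g = g * J" "J * h = h * J" "J * g' = g' * J" "J * h' = h' * J"
    and ac: "g' * g = - (g * g')" "h' * h = - (h * h')" "h' * g = - (g * h')" "h * g' = - (g' * h)"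
  shows "J * ((1 / 2) *\<^sub>R (g - J * h) * (1 / 2) *\<^sub>R (g' + J * h') +
      (1 / 2) *\<^sub>R (g' - J * h') * (1 / 2) *\<^sub>R (g + J * h)) = - (1 / 2) *\<^sub>R (g * h' + g' * h)"
proof -
  have J': "J * (J * x) = - x" "g * (J * x) = J * (g * x)" "h * (J * x) = J * (h * x)"
     "g' * (J * x) = J * (g' * x)" "h' * (J * x) = J * (h' * x)" for x
    by (metis J(1) mult.assoc mult_minus1, metis J(2) mult.assoc, metis J(3) mult.assoc,
        metis J(4) mult.assoc, metis J(5) mult.assoc)
  have "(g - J * h) * (g' + J * h') + (g' - J * h') * (g + J * h) = 2 *\<^sub>R (J * (g * h' + g' * h))"
    by (simp add: algebra_simps J(1) J(2-5)[symmetric] J' ac scaleR_2)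
  then have "(1 / 2) *\<^sub>R (g - J * h) * (1 / 2) *\<^sub>R (g' + J * h') +
      (1 / 2) *\<^sub>R (g' - J * h') * (1 / 2) *\<^sub>R (g + J * h) = (1 / 2) *\<^sub>R (J * (g * h' + g' * h))"
    by (simp flip: scaleR_add_right)
  then show ?thesis
    by (simp add: J' scaleR_add_right scaleR_diff_right)
qed

lemma commute_mult:
  fixes x y z :: "'a::semigroup_mult"
  assumes "x * y = y * x" "x * z = z * x"
  shows "x * (y * z) = (y * z) * x"
  using assms by (metis mult.assoc)

text \<open>Every corner in {a, c} is joined to every corner in {b, d}, so the sum over the edges is
  a product of sums over these two classes.\<close>

lemma cycle_factorization:
  fixes g h :: "'i \<Rightarrow> 'a::real_algebra_1"
  defines "K \<equiv> \<lambda>i j. - (1 / 2) *\<^sub>R (g i * h j + g j * h i)"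
  shows "K a b + K b c + K c d + K d a =
    - ((1 / 2) *\<^sub>R ((g a + g c) * (h b + h d)) + (1 / 2) *\<^sub>R ((g b + g d) * (h a + h c)))"
  by (simp add: K_def algebra_simps)

lemma scalar_op_i_square: "scalar_op n \<i> * scalar_op n \<i> = - 1"
  using scalar_op_of_real[of n "-1"] by (simp add: scalar_op_mult)

lemma scalar_op_commute_tensor: "mat2 f \<Longrightarrow> scalar_op n c * tensor_op n f = tensor_op n f * scalar_op n c"
  unfolding tensor_op_def by (rule scalar_op_commute) simp

lemma scalar_op_commute_majorana: "scalar_op n c * majorana n m = majorana n m * scalar_op n c"
  unfolding majorana_def by (rule scalar_op_commute_tensor) simp

lemma jordan_wigner_tensor: "k < n \<Longrightarrow> jordan_wigner n k = tensor n (jw_string k (ketbra 0 1))"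
proof -
  assume "k < n"
  then have "replicate k pauli_Z @ [ketbra 0 1] @ replicate (n - Suc k) (1\<^sub>m 2) =
      map (jw_string k (ketbra 0 1)) [0..<n]"
    by (intro nth_equalityI) (auto simp: nth_append jw_string_def nth_Cons split: nat.splits)
  then show ?thesis
    by (simp add: jordan_wigner_def tensor_def)
qed

lemma jordan_wigner_adjoint_tensor:
  assumes "k < n"
  shows "mat_adjoint (jordan_wigner n k) = tensor n (jw_string k (M2 0 0 1 0))"
proof -
  have "(\<lambda>j. mat_adjoint (jw_string k (ketbra 0 1) j)) = jw_string k (M2 0 0 1 0)"
    by (auto simp: jw_string_def M2_simps)
  then show ?thesis
    by (simp add: jordan_wigner_tensor[OF assms] tensor_adjoint)
qed

lemma jw_string_combine:
  assumes "k < n"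
  shows "tensor_op n (jw_string k (a \<cdot>\<^sub>m pauli_X + b \<cdot>\<^sub>m pauli_Y)) =
    scalar_op n a * majorana n (2 * k) + scalar_op n b * majorana n (Suc (2 * k))"
proof -
  have "tensor_op n (jw_string k (a \<cdot>\<^sub>m pauli_X + b \<cdot>\<^sub>m pauli_Y)) =
      tensor_op n (jw_string k (a \<cdot>\<^sub>m pauli_X)) + tensor_op n (jw_string k (b \<cdot>\<^sub>m pauli_Y))"
    using assms by (intro tensor_op_add[of _ _ k]) (auto simp: jw_string_def)
  moreover have "tensor_op n (jw_string k (c \<cdot>\<^sub>m P)) = scalar_op n c * tensor_op n (jw_string k P)"
    if "P \<in> carrier_mat 2 2" for c P
    using assms that by (intro tensor_op_smult[of _ k]) (auto simp: jw_string_def)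
  ultimately show ?thesis
    by (simp add: majorana_def)
qed

section \<open>The Hubbard terms for a fixed ordering of the modes\<close>

locale mode_ordering =
  fixes L :: nat and pos :: "mode \<Rightarrow> nat"
  assumes bij: "bij_betw pos (modes L) {..<num_modes L}"
begin

abbreviation "N \<equiv> num_modes L"
abbreviation "J \<equiv> scalar_op N \<i>"
abbreviation "g m \<equiv> majorana N (2 * pos m)"
abbreviation "h m \<equiv> majorana N (Suc (2 * pos m))"

lemma pos_less: "m \<in> modes L \<Longrightarrow> pos m < N"
  using bij by (auto simp: bij_betw_def)

lemma pos_eq_iff: "m \<in> modes L \<Longrightarrow> m' \<in> modes L \<Longrightarrow> pos m = pos m' \<longleftrightarrow> m = m'"
  using bij by (auto simp: bij_betw_def inj_on_eq_iff)

lemma annihilate_carrier [simp]: "m \<in> modes L \<Longrightarrow> annihilate L pos m \<in> carrier_mat (2 ^ N) (2 ^ N)"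
  by (simp add: annihilate_def jordan_wigner_tensor pos_less M2_simps)

lemma create_carrier [simp]: "m \<in> modes L \<Longrightarrow> create L pos m \<in> carrier_mat (2 ^ N) (2 ^ N)"
  by (simp add: create_def annihilate_def jordan_wigner_adjoint_tensor pos_less)

lemma annihilate_majorana:
  assumes "m \<in> modes L"
  shows "qop N (annihilate L pos m) = (1 / 2) *\<^sub>R (g m + J * h m)"
proof -
  \<comment> \<open>On the qubit of the mode the factor is (X + i Y) / 2. Its coefficients are
    written with a real 1/2, so that they become real scalings, with i left over as J.\<close>
  have "ketbra 0 1 = complex_of_real (1 / 2) \<cdot>\<^sub>m pauli_X + (complex_of_real (1 / 2) * \<i>) \<cdot>\<^sub>m pauli_Y"
    by (simp add: M2_simps pauli_Y_def)
  then show ?thesis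
    using pos_less[OF assms]
    by (simp only: annihilate_def jordan_wigner_tensor tensor_op_def[symmetric] jw_string_combine
        scalar_op_mult[symmetric] scalar_op_of_real) (simp add: scaleR_add_right)
qed

lemma create_majorana:
  assumes "m \<in> modes L"
  shows "qop N (create L pos m) = (1 / 2) *\<^sub>R (g m - J * h m)"
proof -
  have "M2 0 0 1 0 = complex_of_real (1 / 2) \<cdot>\<^sub>m pauli_X + (complex_of_real (- 1 / 2) * \<i>) \<cdot>\<^sub>m pauli_Y"
    by (simp add: M2_simps pauli_Y_def)
  then show ?thesis
    using pos_less[OF assms]
    by (simp only: create_def annihilate_def jordan_wigner_adjoint_tensor tensor_op_def[symmetric]
        jw_string_combine scalar_op_mult[symmetric] scalar_op_of_real) (simp add: scaleR_diff_right)
qed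

lemma edge_hopping_majorana:
  assumes "i \<in> sites L" "j \<in> sites L" "i \<noteq> j"
  shows "J * qop N (edge_hopping L pos s {i, j}) =
    - (1 / 2) *\<^sub>R (g (i, s) * h (j, s) + g (j, s) * h (i, s))"
proof -
  have m: "(i, s) \<in> modes L" "(j, s) \<in> modes L"
    using assms by (auto simp: modes_def)
  have "{(a, b). a \<in> {i, j} \<and> b \<in> {i, j} \<and> a \<noteq> b} = {(i, j), (j, i)}"
    using assms(3) by auto
  then have "qop N (edge_hopping L pos s {i, j}) =
      qop N (mat_sum (2 ^ N) (\<lambda>(i, j). create L pos (i, s) * annihilate L pos (j, s)) {(i, j), (j, i)})"
    by (simp only: edge_hopping_def)
  also have "\<dots> = (\<Sum>x\<in>{(i, j), (j, i)}. qop N (case x of (i, j) \<Rightarrow> create L pos (i, s) * annihilate L pos (j, s)))"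
    by (rule mat_op_mat_sum) (use m in \<open>auto simp: mult_carrier_mat[of _ "2 ^ N" "2 ^ N"]\<close>)
  also have "\<dots> = qop N (create L pos (i, s)) * qop N (annihilate L pos (j, s)) +
      qop N (create L pos (j, s)) * qop N (annihilate L pos (i, s))"
    using m assms(3) by (simp add: mat_op_mult)
  finally have *: "qop N (edge_hopping L pos s {i, j}) =
      qop N (create L pos (i, s)) * qop N (annihilate L pos (j, s)) +
      qop N (create L pos (j, s)) * qop N (annihilate L pos (i, s))" .
  have ne: "pos (i, s) \<noteq> pos (j, s)" "pos (i, s) < N" "pos (j, s) < N"
    using m assms(3) by (auto simp: pos_eq_iff pos_less)
  then have ne': "2 * pos (i, s) \<noteq> Suc (2 * pos (j, s))" "2 * pos (j, s) \<noteq> Suc (2 * pos (i, s))"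
    by presburger+
  show ?thesis
    unfolding * annihilate_majorana[OF m(1)] annihilate_majorana[OF m(2)]
      create_majorana[OF m(1)] create_majorana[OF m(2)]
    by (rule hopping_majorana[OF scalar_op_i_square scalar_op_commute_majorana scalar_op_commute_majorana
          scalar_op_commute_majorana scalar_op_commute_majorana])
      (rule majorana_anticommute; use ne ne' in simp)+
qed

lemma edge_hopping_carrier: "edge_hopping L pos s e \<in> carrier_mat (2 ^ N) (2 ^ N)"
  by (simp add: edge_hopping_def mat_sum_def)

text \<open>The i of the exponent is moved onto the single edge terms, which become real
  combinations of Majorana products; only the real number x * \<tau> stays in front.\<close>

lemma exp_H_hopping_on:
  "qop N (exp_i x (H_hopping_on E L \<tau> pos)) =
    exp ((x * \<tau>) *\<^sub>R (\<Sum>(s, e)\<in>UNIV \<times> E. J * qop N (edge_hopping L pos s e)))"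
proof -
  let ?S = "mat_sum (2 ^ N) (\<lambda>(s, e). edge_hopping L pos s e) (UNIV \<times> E)"
  have S: "?S \<in> carrier_mat (2 ^ N) (2 ^ N)"
    by (simp add: mat_sum_def)
  have "(\<i> * complex_of_real x) \<cdot>\<^sub>m H_hopping_on E L \<tau> pos = complex_of_real (x * \<tau>) \<cdot>\<^sub>m (\<i> \<cdot>\<^sub>m ?S)"
    unfolding H_hopping_on_def by (rule eq_matI) auto
  then have "qop N (exp_i x (H_hopping_on E L \<tau> pos)) = exp ((x * \<tau>) *\<^sub>R (J * qop N ?S))"
    unfolding exp_i_def using S by (simp add: mat_op_mat_exp mat_op_scaleR scalar_op_mult_qop del: of_real_mult)
  also have "qop N ?S = (\<Sum>(s, e)\<in>UNIV \<times> E. qop N (edge_hopping L pos s e))"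
    by (subst mat_op_mat_sum) (auto simp: edge_hopping_carrier intro!: sum.cong)
  finally show ?thesis
    by (simp add: sum_distrib_left case_prod_unfold)
qed

text \<open>The strings of the creation and annihilation operator square to 1, leaving the
  occupation number diag(0, 1) on one qubit, and 2 diag(0, 1) - 1 = -Z.\<close>

lemma z_hat_site_op:
  assumes "m \<in> modes L"
  shows "qop N (z_hat L pos m) = - site_op N (pos m) pauli_Z"
proof -
  have k: "pos m < N" using pos_less[OF assms] .
  have "qop N (create L pos m) = tensor_op N (jw_string (pos m) (M2 0 0 1 0))"
    by (simp only: create_def annihilate_def jordan_wigner_adjoint_tensor[OF k] tensor_op_def)
  moreover have "qop N (annihilate L pos m) = tensor_op N (jw_string (pos m) (ketbra 0 1))"
    by (simp only: annihilate_def jordan_wigner_tensor[OF k] tensor_op_def)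
  ultimately have "qop N (create L pos m * annihilate L pos m) =
      tensor_op N (jw_string (pos m) (M2 0 0 1 0)) * tensor_op N (jw_string (pos m) (ketbra 0 1))"
    using assms by (simp add: mat_op_mult)
  also have "\<dots> = site_op N (pos m) (M2 0 0 0 1)"
    unfolding site_op_def
    by (subst tensor_op_mult) (auto simp: jw_string_def on_site_def M2_simps intro!: tensor_op_cong)
  finally have "qop N (z_hat L pos m) = 2 *\<^sub>R site_op N (pos m) (M2 0 0 0 1) - 1"
  proof -
    assume *: "qop N (create L pos m * annihilate L pos m) = site_op N (pos m) (M2 0 0 0 1)"
    have c: "create L pos m * annihilate L pos m \<in> carrier_mat (2 ^ N) (2 ^ N)"
      using assms by (simp add: mult_carrier_mat[of _ "2 ^ N" "2 ^ N"])
    have "z_hat L pos m = complex_of_real 2 \<cdot>\<^sub>m (create L pos m * annihilate L pos m) + - 1\<^sub>m (2 ^ N)"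
      unfolding z_hat_def using c by (intro eq_matI) auto
    then show ?thesis
      using c by (simp only:) (subst mat_op_add, auto simp: mat_op_uminus mat_op_one mat_op_scaleR * 
          simp del: of_real_numeral)
  qed
  also have "\<dots> = site_op N (pos m) (complex_of_real 2 \<cdot>\<^sub>m M2 0 0 0 1 + - 1\<^sub>m 2)"
    using k by (subst site_op_add) (auto simp: site_op_scaleR site_op_uminus site_op_one simp del: of_real_numeral)
  also have "complex_of_real 2 \<cdot>\<^sub>m M2 0 0 0 1 + - 1\<^sub>m 2 = - pauli_Z"
    by (simp add: M2_simps)
  finally show ?thesis
    using k by (simp add: site_op_uminus)
qed

lemma z_hat_carrier: "m \<in> modes L \<Longrightarrow> z_hat L pos m \<in> carrier_mat (2 ^ N) (2 ^ N)"
  by (auto simp: z_hat_def)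

text \<open>The signs of the two spins cancel, so a site contributes a multiple of the generator i Z
  Z on its two qubits. These all commute, being products of Z operators and i.\<close>

lemma implements_exp_H_interaction:
  "implements N 0 (L\<^sup>2) (qop N (exp_i x (H_interaction L u pos)))"
proof -
  define f where "f i = J * (site_op N (pos (i, Up)) pauli_Z * site_op N (pos (i, Down)) pauli_Z)" for i
  let ?S = "mat_sum (2 ^ N) (\<lambda>i. z_hat L pos (i, Up) * z_hat L pos (i, Down)) (sites L)"
  define y where "y = x * (u / 4)"
  have S: "?S \<in> carrier_mat (2 ^ N) (2 ^ N)"
    by (simp add: mat_sum_def)
  have m: "(i, s) \<in> modes L" if "i \<in> sites L" for i s
    using that by (auto simp: modes_def)
  have "(\<i> * complex_of_real x) \<cdot>\<^sub>m H_interaction L u pos = complex_of_real y \<cdot>\<^sub>m (\<i> \<cdot>\<^sub>m ?S)"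
    unfolding H_interaction_def y_def by (rule eq_matI) auto
  then have "qop N (exp_i x (H_interaction L u pos)) = exp (y *\<^sub>R (J * qop N ?S))"
    unfolding exp_i_def using S by (simp add: mat_op_mat_exp mat_op_scaleR scalar_op_mult_qop)
  also have "qop N ?S = (\<Sum>i\<in>sites L. qop N (z_hat L pos (i, Up)) * qop N (z_hat L pos (i, Down)))"
    by (subst mat_op_mat_sum)
      (auto simp: z_hat_carrier m mat_op_mult intro!: sum.cong mult_carrier_mat[of _ "2 ^ N" "2 ^ N"])
  also have "J * \<dots> = (\<Sum>i\<in>sites L. f i)"
    unfolding sum_distrib_left by (intro sum.cong) (auto simp: z_hat_site_op m f_def)
  also have "y *\<^sub>R \<dots> = (\<Sum>i\<in>sites L. y *\<^sub>R f i)"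
    by (rule scaleR_sum_right)
  finally have eq: "qop N (exp_i x (H_interaction L u pos)) = exp (\<Sum>i\<in>sites L. y *\<^sub>R f i)" .
  have "implements N (card (sites L) * 0) (card (sites L) * 1) (exp (\<Sum>i\<in>sites L. y *\<^sub>R f i))"
  proof (rule implements_exp_sum)
    show "finite (sites L)" by (simp add: sites_def)
    fix i assume i: "i \<in> sites L"
    have "pos (i, Up) \<noteq> pos (i, Down)"
      using i by (simp add: pos_eq_iff m)
    then have "generator N (f i)"
      unfolding f_def using i by (intro generator_ZZ) (auto simp: pos_less m)
    then show "implements N 0 1 (exp (y *\<^sub>R f i))"
      by (rule implements_exp_generator)
  next
    fix i j assume ij: "i \<in> sites L" "j \<in> sites L"
    have Z: "site_op N p pauli_Z * site_op N q pauli_Z = site_op N q pauli_Z * site_op N p pauli_Z" for p q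
      by (cases "p = q") (simp_all add: site_op_commute)
    have JZ: "J * site_op N (pos (i, s)) pauli_Z = site_op N (pos (i, s)) pauli_Z * J" if "i \<in> sites L" for i s
      using that by (intro scalar_op_commute_site) (auto simp: pos_less m)
    have "site_op N (pos (i, s)) pauli_Z * f j = f j * site_op N (pos (i, s)) pauli_Z" for s
      unfolding f_def by (intro commute_mult Z JZ[OF ij(1), symmetric])
    moreover have "J * f j = f j * J"
      unfolding f_def by (intro commute_mult JZ[OF ij(2)] refl)
    ultimately have "f j * f i = f i * f j"
      unfolding f_def[of i] by (intro commute_mult) simp_all
    then show "y *\<^sub>R f i * y *\<^sub>R f j = y *\<^sub>R f j * y *\<^sub>R f i"
      by simp
  qed
  then show ?thesis
    unfolding eq by (simp add: sites_def power2_eq_square)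
qed

end

section \<open>Plaquettes\<close>

text \<open>Corners run counterclockwise from the lower left, so opposite corners have indices of
  the same parity.\<close>

definition corner :: "nat \<Rightarrow> site \<Rightarrow> nat \<Rightarrow> site" where
  "corner L = (\<lambda>(x, y) k. (if k = 1 \<or> k = 2 then (x + 1) mod L else x, if k = 2 \<or> k = 3 then (y + 1) mod L else y))"

text \<open>Both colours at once: r = 0 is pink and r = 1 is gold.\<close>

definition parity_plaquettes :: "nat \<Rightarrow> nat \<Rightarrow> site set" where
  "parity_plaquettes L r = {x. x < L \<and> x mod 2 = r} \<times> {y. y < L \<and> y mod 2 = r}"

lemma pink_plaquettes_altdef: "pink_plaquettes L = parity_plaquettes L 0"
  by (auto simp: pink_plaquettes_def parity_plaquettes_def sites_def even_iff_mod_2_eq_zero)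

lemma gold_plaquettes_altdef: "gold_plaquettes L = parity_plaquettes L 1"
  by (auto simp: gold_plaquettes_def parity_plaquettes_def sites_def odd_iff_mod_2_eq_one)

lemma card_parity_plaquettes:
  assumes "even L" "r < 2"
  shows "4 * card (parity_plaquettes L r) = L\<^sup>2"
proof -
  obtain l where l: "L = 2 * l" using assms(1) by (elim evenE)
  have "x < L \<and> x mod 2 = r \<longleftrightarrow> (\<exists>k<l. x = 2 * k + r)" for x
  proof
    assume x: "x < L \<and> x mod 2 = r"
    then have "x = 2 * (x div 2) + r" "x div 2 < l"
      unfolding l by presburger+
    then show "\<exists>k<l. x = 2 * k + r" by blast
  next
    assume "\<exists>k<l. x = 2 * k + r"
    then show "x < L \<and> x mod 2 = r"
      using assms(2) l by auto
  qed
  then have "{x. x < L \<and> x mod 2 = r} = (\<lambda>k. 2 * k + r) ` {..<l}"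
    by blast
  also have "card \<dots> = l"
    by (subst card_image) (auto simp: inj_on_def)
  finally show ?thesis
    by (simp add: parity_plaquettes_def card_cartesian_product l power2_eq_square)
qed

lemma finite_parity_plaquettes: "finite (parity_plaquettes L r)"
  by (simp add: parity_plaquettes_def)

text \<open>The flags b and c tell whether a coordinate is shifted. For even L, parity survives
  reduction modulo L, so a shifted and an unshifted coordinate never meet; two shifted ones meet
  only if they start from the same value.\<close>

lemma cyclic_successor_eq_iff:
  fixes L x u :: nat
  assumes "even L" "x < L" "u < L" "x mod 2 = u mod 2"
  shows "(if b then (x + 1) mod L else x) = (if c then (u + 1) mod L else u) \<longleftrightarrow> x = u \<and> b = c"
proof -
  have parity: "(v + 1) mod L \<noteq> w" if "v mod 2 = w mod 2" for v w :: nat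
  proof
    assume "(v + 1) mod L = w"
    then have "w mod 2 = (v + 1) mod 2"
      using mod_mod_cancel[OF assms(1), of "v + 1"] by simp
    with that show False by presburger
  qed
  have "(v + 1) mod L = (if v + 1 = L then 0 else v + 1)" if "v < L" for v :: nat
    using that by auto
  then have "(x + 1) mod L = (u + 1) mod L \<longleftrightarrow> x = u"
    using assms(2,3) by auto
  then show ?thesis
    using parity[of x u] parity[of u x] assms(4) by auto
qed

text \<open>Plaquettes of one colour have no vertex in common: each coordinate of a corner
  determines that of the plaquette and whether it was shifted, and the two shifts determine
  k.\<close>

lemma corner_eq_iff:
  assumes "even L" "p \<in> parity_plaquettes L r" "p' \<in> parity_plaquettes L r" "k < 4" "k' < 4"
  shows "corner L p k = corner L p' k' \<longleftrightarrow> p = p' \<and> k = k'"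
proof -
  obtain x y x' y' where p: "p = (x, y)" "p' = (x', y')" by fastforce
  have "corner L p k = corner L p' k' \<longleftrightarrow> (x = x' \<and> (k = 1 \<or> k = 2) = (k' = 1 \<or> k' = 2)) \<and>
      (y = y' \<and> (k = 2 \<or> k = 3) = (k' = 2 \<or> k' = 3))"
    unfolding corner_def p prod.case prod.inject
    by (intro arg_cong2[where f = "(\<and>)"] cyclic_successor_eq_iff assms(1))
      (use assms(2,3) p in \<open>auto simp: parity_plaquettes_def\<close>)
  moreover have "((k = 1 \<or> k = 2) = (k' = 1 \<or> k' = 2)) \<and> ((k = 2 \<or> k = 3) = (k' = 2 \<or> k' = 3)) \<longleftrightarrow> k = k'"
    using assms(4,5) by presburger
  ultimately show ?thesis
    unfolding p by blast
qed

lemma corner_in_sites: "p \<in> parity_plaquettes L r \<Longrightarrow> corner L p k \<in> sites L"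
  by (auto simp: parity_plaquettes_def corner_def sites_def)

lemma plaquette_edges_corner:
  "plaquette_edges L p = {{corner L p 0, corner L p 1}, {corner L p 1, corner L p 2},
    {corner L p 2, corner L p 3}, {corner L p 3, corner L p 0}}"
  by (cases p) (simp add: plaquette_edges_def corner_def Let_def)

lemma UNIV_spin: "(UNIV :: spin set) = {Up, Down}"
  using spin.exhaust by auto

text \<open>The edges form a set, so distinctness of the corners is what makes the sum have four
  terms.\<close>

lemma sum_plaquette_edges:
  fixes f :: "site set \<Rightarrow> 'b::comm_monoid_add"
  assumes "even L" "p \<in> parity_plaquettes L r"
  shows "sum f (plaquette_edges L p) = f {corner L p 0, corner L p 1} + f {corner L p 1, corner L p 2} +
    f {corner L p 2, corner L p 3} + f {corner L p 3, corner L p 0}"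
  unfolding plaquette_edges_corner
  by (simp add: doubleton_eq_iff corner_eq_iff[OF assms(1,2,2)] add.assoc)

lemma sum_edges_of_plaquettes:
  fixes f :: "site set \<Rightarrow> 'b::comm_monoid_add"
  assumes "even L"
  shows "sum f (\<Union>p\<in>parity_plaquettes L r. plaquette_edges L p) =
    (\<Sum>p\<in>parity_plaquettes L r. sum f (plaquette_edges L p))"
proof (rule sum.UNION_disjoint)
  show "\<forall>p\<in>parity_plaquettes L r. \<forall>p'\<in>parity_plaquettes L r. p \<noteq> p' \<longrightarrow>
      plaquette_edges L p \<inter> plaquette_edges L p' = {}"
    by (auto simp: plaquette_edges_corner doubleton_eq_iff corner_eq_iff[OF assms])
qed (auto simp: finite_parity_plaquettes plaquette_edges_corner)

lemma majorana_sum_anticommute: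
  assumes "{i, j} \<inter> {k, l} = {}" "{i, j, k, l} \<subseteq> {..<2 * n}"
  shows "(majorana n k + majorana n l) * (majorana n i + majorana n j) =
    - ((majorana n i + majorana n j) * (majorana n k + majorana n l))"
  using assms majorana_anticommute[of k i n] majorana_anticommute[of k j n]
    majorana_anticommute[of l i n] majorana_anticommute[of l j n]
  by (simp add: algebra_simps)

section \<open>The hopping exponentials of one colour, and the Trotter step\<close>

context mode_ordering
begin

text \<open>Here \<open>b\<close> ranges over \<open>{0, 1}\<close>, so that the subtractions do not truncate.\<close>

definition half_plaquette :: "spin \<times> site \<times> nat \<Rightarrow> seq_op" where
  "half_plaquette = (\<lambda>(s, p, b). (1 / 2) *\<^sub>R
     ((g (corner L p b, s) + g (corner L p (b + 2), s)) * (h (corner L p (1 - b), s) + h (corner L p (3 - b), s))))"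

text \<open>The minus sign is that of a single edge term in Majorana form. Each spin and plaquette
  leaves two halves: g sits on the even corners for b = 0 and on the odd ones for b = 1.\<close>

lemma sum_edge_hopping:
  assumes "even L"
  shows "(\<Sum>(s, e)\<in>UNIV \<times> (\<Union>p\<in>parity_plaquettes L r. plaquette_edges L p). J * qop N (edge_hopping L pos s e)) =
    - (\<Sum>i\<in>UNIV \<times> parity_plaquettes L r \<times> {0, 1}. half_plaquette i)"
proof -
  let ?P = "parity_plaquettes L r"
  let ?F = "\<lambda>s e. J * qop N (edge_hopping L pos s e)"
  have "sum (?F s) (plaquette_edges L p) = - (half_plaquette (s, p, 0) + half_plaquette (s, p, 1))"
    if p: "p \<in> ?P" for s p
  proof -
    define K where "K k l = - (1 / 2) *\<^sub>R
      (g (corner L p k, s) * h (corner L p l, s) + g (corner L p l, s) * h (corner L p k, s))" for k l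
    have "?F s {corner L p k, corner L p l} = K k l" if "k \<noteq> l" "k < 4" "l < 4" for k l
      unfolding K_def using that corner_eq_iff[OF assms p p]
      by (intro edge_hopping_majorana corner_in_sites[OF p]) auto
    then have "sum (?F s) (plaquette_edges L p) = K 0 1 + K 1 2 + K 2 3 + K 3 0"
      unfolding sum_plaquette_edges[OF assms p] by simp
    also have "\<dots> = - ((1 / 2) *\<^sub>R ((g (corner L p 0, s) + g (corner L p 2, s)) * (h (corner L p 1, s) + h (corner L p 3, s))) +
        (1 / 2) *\<^sub>R ((g (corner L p 1, s) + g (corner L p 3, s)) * (h (corner L p 0, s) + h (corner L p 2, s))))"
      unfolding K_def by (rule cycle_factorization)
    finally show ?thesis
      by (simp add: half_plaquette_def numeral_eq_Suc)
  qed
  then have "(\<Sum>s\<in>UNIV. \<Sum>p\<in>?P. sum (?F s) (plaquette_edges L p)) =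
      (\<Sum>s\<in>UNIV. \<Sum>p\<in>?P. - (\<Sum>b\<in>{0, 1}. half_plaquette (s, p, b)))"
    by (intro sum.cong) auto
  moreover have "sum f (A \<times> B \<times> C) = (\<Sum>a\<in>A. \<Sum>b\<in>B. \<Sum>c\<in>C. f (a, b, c))"
    for f :: "spin \<times> site \<times> nat \<Rightarrow> seq_op" and A B C
    by (simp add: sum.cartesian_product case_prod_unfold)
  ultimately show ?thesis
    by (simp only: sum.cartesian_product[symmetric] sum_edges_of_plaquettes[OF assms] sum_negf)
qed

lemma majorana_corner_eq_iff:
  assumes "even L" "p \<in> parity_plaquettes L r" "p' \<in> parity_plaquettes L r" "k < 4" "k' < 4"
  shows "pos (corner L p k, s) = pos (corner L p' k', s') \<longleftrightarrow> p = p' \<and> k = k' \<and> s = s'"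
  using assms by (subst pos_eq_iff) (auto simp: modes_def corner_in_sites corner_eq_iff)

lemma pos_corner_less:
  "p \<in> parity_plaquettes L r \<Longrightarrow> pos (corner L p k, s) < N"
  by (rule pos_less) (auto simp: modes_def corner_in_sites)

text \<open>Different halves share no Majorana operator: another spin or plaquette means other
  modes, and if only b differs, g and h have exchanged their corners. So each factor of one half
  anticommutes with each factor of the other, and the products of two factors commute.\<close>

lemma half_plaquette_commute:
  assumes "even L" "i \<in> UNIV \<times> parity_plaquettes L r \<times> {0, 1}" "i' \<in> UNIV \<times> parity_plaquettes L r \<times> {0, 1}"
  shows "half_plaquette i * half_plaquette i' = half_plaquette i' * half_plaquette i"
proof (cases "i = i'")
  case False
  obtain s p b s' p' b' where i: "i = (s, p, b)" "i' = (s', p', b')"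
    and p: "p \<in> parity_plaquettes L r" "p' \<in> parity_plaquettes L r" and b: "b = 0 \<or> b = 1" "b' = 0 \<or> b' = 1"
    using assms(2,3) by auto
  \<comment> \<open>The listed pairs compare g corners with g corners and h corners with h corners.
    A g and an h always differ, their indices being even and odd.\<close>
  have ne: "pos (corner L p k, s) \<noteq> pos (corner L p' k', s')"
    if "k = b \<and> k' = b' \<or> k = b + 2 \<and> k' = b' \<or> k = b \<and> k' = b' + 2 \<or> k = b + 2 \<and> k' = b' + 2 \<or>
      k = 1 - b \<and> k' = 1 - b' \<or> k = 3 - b \<and> k' = 1 - b' \<or> k = 1 - b \<and> k' = 3 - b' \<or> k = 3 - b \<and> k' = 3 - b'"
    for k k'
    using that b False i by (subst majorana_corner_eq_iff[OF assms(1) p]) auto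
  have odd: "2 * m \<noteq> Suc (2 * m')" "Suc (2 * m) \<noteq> 2 * m'" for m m' :: nat
    by presburger+
  have less: "pos (corner L q k, t) < N" "Suc (2 * pos (corner L q k, t)) < 4 * L\<^sup>2"
    if "q = p \<or> q = p'" for q k t
  proof -
    show "pos (corner L q k, t) < N"
      using that p pos_corner_less by blast
    then show "Suc (2 * pos (corner L q k, t)) < 4 * L\<^sup>2"
      by linarith
  qed
  have "(g (corner L p b, s) + g (corner L p (b + 2), s)) * (h (corner L p (1 - b), s) + h (corner L p (3 - b), s)) *
     ((g (corner L p' b', s') + g (corner L p' (b' + 2), s')) * (h (corner L p' (1 - b'), s') + h (corner L p' (3 - b'), s'))) =
     (g (corner L p' b', s') + g (corner L p' (b' + 2), s')) * (h (corner L p' (1 - b'), s') + h (corner L p' (3 - b'), s')) *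
    ((g (corner L p b, s) + g (corner L p (b + 2), s)) * (h (corner L p (1 - b), s) + h (corner L p (3 - b), s)))"
    by (rule even_product_commute; rule majorana_sum_anticommute)
      (simp_all add: ne odd odd[symmetric] less)
  then show ?thesis
    by (simp add: i half_plaquette_def)
qed simp

lemma implements_exp_hopping:
  assumes "even L" "r < 2"
  shows "implements N (4 * L\<^sup>2) (L\<^sup>2)
    (qop N (exp_i x (H_hopping_on (\<Union>p\<in>parity_plaquettes L r. plaquette_edges L p) L \<tau> pos)))"
proof -
  let ?I = "(UNIV :: spin set) \<times> parity_plaquettes L r \<times> {0, 1 :: nat}"
  \<comment> \<open>Two spins and two halves for each of the L^2 / 4 plaquettes.\<close>
  have "card ?I = L\<^sup>2"
    using card_parity_plaquettes[OF assms] by (simp add: card_cartesian_product UNIV_spin)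
  \<comment> \<open>The minus sign of \<open>sum_edge_hopping\<close> goes into the free rotation
    angle.\<close>
  moreover have "implements N (card ?I * 4) (card ?I * 1) (exp (\<Sum>i\<in>?I. - (x * \<tau>) *\<^sub>R half_plaquette i))"
  proof (rule implements_exp_sum)
    show "finite ?I"
      by (simp add: UNIV_spin finite_parity_plaquettes)
    fix i assume "i \<in> ?I"
    then obtain s p b where i: "i = (s, p, b)" "p \<in> parity_plaquettes L r" "b = 0 \<or> b = 1"
      by auto
    have "2 * m \<noteq> Suc (2 * m')" "Suc (2 * m) \<noteq> 2 * m'" for m m' :: nat
      by presburger+
    moreover have "Suc (2 * pos (corner L p k, t)) < 4 * L\<^sup>2" for k t
      using pos_corner_less[OF i(2), of k t] by linarith
    ultimately show "implements N 4 1 (exp (- (x * \<tau>) *\<^sub>R half_plaquette i))"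
      unfolding i(1) half_plaquette_def prod.case
      using pos_corner_less[OF i(2)] i(3) majorana_corner_eq_iff[OF assms(1) i(2) i(2), of _ _ s s]
      by (intro implements_exp_majorana_sums) auto
  next
    fix i j assume "i \<in> ?I" "j \<in> ?I"
    then show "- (x * \<tau>) *\<^sub>R half_plaquette i * - (x * \<tau>) *\<^sub>R half_plaquette j =
        - (x * \<tau>) *\<^sub>R half_plaquette j * - (x * \<tau>) *\<^sub>R half_plaquette i"
      using half_plaquette_commute[OF assms(1), of i r j] by simp
  qed
  moreover have "(\<Sum>i\<in>?I. - (x * \<tau>) *\<^sub>R half_plaquette i) = (x * \<tau>) *\<^sub>R (- (\<Sum>i\<in>?I. half_plaquette i))"
    by (simp add: scaleR_sum_right sum_negf)
  ultimately show ?thesis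
    by (simp add: exp_H_hopping_on sum_edge_hopping[OF assms(1)] mult.commute)
qed

lemma exp_i_carrier: "A \<in> carrier_mat m m \<Longrightarrow> exp_i x A \<in> carrier_mat m m"
  by (simp add: exp_i_def mat_exp_def)

lemma implements_plaquette_trotter_step:
  assumes "even L"
  shows "implements N (12 * L\<^sup>2) (4 * L\<^sup>2) (qop N (plaquette_trotter_step L u \<tau> t pos))"
    "plaquette_trotter_step L u \<tau> t pos \<in> carrier_mat (2 ^ N) (2 ^ N)"
proof -
  have carr: "exp_i x (H_pink L \<tau> pos) \<in> carrier_mat (2 ^ N) (2 ^ N)"
    "exp_i x (H_gold L \<tau> pos) \<in> carrier_mat (2 ^ N) (2 ^ N)"
    "exp_i x (H_interaction L u pos) \<in> carrier_mat (2 ^ N) (2 ^ N)" for x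
    by (rule exp_i_carrier; simp add: H_pink_def H_gold_def H_hopping_on_def H_interaction_def mat_sum_def)+
  note mc = mult_carrier_mat[of _ "2 ^ N" "2 ^ N"]
  show "plaquette_trotter_step L u \<tau> t pos \<in> carrier_mat (2 ^ N) (2 ^ N)"
    unfolding plaquette_trotter_step_def by (intro mc carr)
  have pink: "implements N (4 * L\<^sup>2) (L\<^sup>2) (qop N (exp_i x (H_pink L \<tau> pos)))" for x
    unfolding H_pink_def pink_edges_def pink_plaquettes_altdef by (rule implements_exp_hopping[OF assms]) simp
  have gold: "implements N (4 * L\<^sup>2) (L\<^sup>2) (qop N (exp_i x (H_gold L \<tau> pos)))" for x
    unfolding H_gold_def gold_edges_def gold_plaquettes_altdef by (rule implements_exp_hopping[OF assms]) simp
  have "qop N (plaquette_trotter_step L u \<tau> t pos) =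
      qop N (exp_i (t / 2) (H_pink L \<tau> pos)) * qop N (exp_i t (H_gold L \<tau> pos)) *
      qop N (exp_i (t / 2) (H_pink L \<tau> pos)) * qop N (exp_i t (H_interaction L u pos))"
    unfolding plaquette_trotter_step_def by (simp add: mat_op_mult mc carr)
  moreover have "implements N (4 * L\<^sup>2 + 4 * L\<^sup>2 + 4 * L\<^sup>2 + 0) (L\<^sup>2 + L\<^sup>2 + L\<^sup>2 + L\<^sup>2) \<dots>"
    by (intro implements_mult pink gold implements_exp_H_interaction)
  moreover have "4 * L\<^sup>2 + 4 * L\<^sup>2 + 4 * L\<^sup>2 + 0 = 12 * L\<^sup>2" "L\<^sup>2 + L\<^sup>2 + L\<^sup>2 + L\<^sup>2 = 4 * L\<^sup>2"
    by simp_all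
  ultimately show "implements N (12 * L\<^sup>2) (4 * L\<^sup>2) (qop N (plaquette_trotter_step L u \<tau> t pos))"
    by (simp only:)
qed

end

text \<open>In \<open>implements\<close> the phase multiplies the circuit; moved over to the matrix
  it changes its sign.\<close>

lemma implements_circuit:
  assumes "implements n a b (qop n A)" "A \<in> carrier_mat (2 ^ n) (2 ^ n)"
  shows "\<exists>gs \<phi>. valid_circuit n gs \<and> circuit_mat n gs = cis \<phi> \<cdot>\<^sub>m A \<and> T_count gs \<le> a \<and> rotation_count gs \<le> b"
proof -
  obtain gs \<phi> where gs: "valid_circuit n gs" "T_count gs \<le> a" "rotation_count gs \<le> b"
    and A: "qop n A = scalar_op n (cis \<phi>) * circuit_op n gs"
    using assms(1) by (auto simp: implements_def)
  have "scalar_op n (cis (- \<phi>)) * qop n A = scalar_op n (cis (- \<phi>) * cis \<phi>) * circuit_op n gs"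
    by (simp only: A mult.assoc[symmetric] scalar_op_mult)
  then have "qop n (cis (- \<phi>) \<cdot>\<^sub>m A) = qop n (circuit_mat n gs)"
    using assms(2) by (simp add: scalar_op_mult_qop cis_mult circuit_op_def)
  then have "cis (- \<phi>) \<cdot>\<^sub>m A = circuit_mat n gs"
    by (rule mat_op_inject[rotated 2]) (use assms(2) gs(1) in auto)
  with gs show ?thesis
    by metis
qed

theorem mainTheorem3:
  fixes L :: nat and u \<tau> t :: real and pos :: "mode \<Rightarrow> nat"
  assumes "L \<ge> 4" and "even L" and "u > 0" and "\<tau> > 0"
    and "bij_betw pos (modes L) {..<num_modes L}"
  shows "\<exists>(gs :: gate list) (\<phi> :: real).
    valid_circuit (num_modes L) gs \<and>
    circuit_mat (num_modes L) gs = cis \<phi> \<cdot>\<^sub>m plaquette_trotter_step L u \<tau> t pos \<and>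
    T_count gs \<le> 12 * L\<^sup>2 \<and>
    rotation_count gs \<le> 4 * L\<^sup>2"
proof -
  interpret mode_ordering L pos
    using assms(5) by unfold_locales
  show ?thesis
    using implements_circuit[OF implements_plaquette_trotter_step[OF assms(2)]] .
qed

end
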